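(* Assume the standing setting below with a bounded continuous loss function $w:\Theta\times U\to[0,\infty)$. Then $$\inf_{M\in\mathrm{Povm}(U)}\sup_{\theta\in\Theta}R_M(\theta)=\sup_{\pi\in\mathcal{P}(\Theta)}\inf_{M\in\mathrm{Povm}(U)}\int_\Theta R_M(\theta)\,\pi(d\theta).$$
   Context: Standing setting. $\mathcal{H}$ is a complex Hilbert space and $L_1(\mathcal{H})$ the trace-class operators on it; for self-adjoint operators $A\ge B$ means $A-B$ is positive. $\Theta$ and $U$ are compact metric spaces ($d$ the metric on $\Theta$); $C(\Theta)$ is the space of real continuous functions on $\Theta$ with the supremum norm. For compact $K\subseteq\Theta$ and $\delta>0$ let $K_\delta:=\{(\theta,\eta)\in K\times K: d(\theta,\eta)<\delta\}$. For $T:\Theta\to L_1(\mathcal{H})$ with self-adjoint values, $\omega_T(K_\delta):=\inf\{\|X\|_1: X\in L_1(\mathcal{H}),\ -X\le T(\theta)-T(\eta)\le X\ \forall(\theta,\eta)\in K_\delta\}$ (infimum of the empty set is $+\infty$), and $T$ is called regular if $\lim_{\delta\to0}\omega_T(K_\delta)=0$ for every compact $K\subseteq\Theta$. A quantum statistical model is a map $\rho:\Theta\to L_1(\mathcal{H})$ with $\rho(\theta)\ge0$, $\mathrm{Tr}\,\rho(\theta)=1$, which is injective (identifiability) and regular. A POVM on $U$ is a map $M$ from the Borel $\sigma$-algebra of $U$ to bounded operators on $\mathcal{H}$ with $M(B)\ge0$, $M(\bigcup_j B_j)=\sum_j M(B_j)$ for pairwise disjoint $B_j$ (series converging in the weak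 operator topology), and $M(U)=I$; $\mathrm{Povm}(U)$ is the set of all POVMs. For a positive trace-class $T$ and $M\in\mathrm{Povm}(U)$ let $\mu_{T,M}(A):=\mathrm{Tr}\,T M(A)$ and $\mu_{T,M}[f]:=\int_U f\,d\mu_{T,M}$ for $f\in C(U)$. $\mathrm{Povm}(U)$ carries the topology generated by finite intersections of the sets $\{M'\in\mathrm{Povm}(U): |\mu_{T,M}[f]-\mu_{T,M'}[f]|<\epsilon\}$, $\epsilon>0$, $T\ge0$ trace-class, $f\in C(U)$. A loss function is a lower semicontinuous $w:\Theta\times U\to[0,+\infty]$. The risk function of $M$ is $R_M(\theta):=\int_U w(\theta,u)\,\mathrm{Tr}\,\rho(\theta)M(du)$. $\mathcal{P}(\Theta)$ denotes the set of Borel probability measures on $\Theta$. *)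

theory Defs
  imports "HOL-Probability.Probability"
begin

class complex_vector = real_vector +
  fixes scaleC :: "complex \<Rightarrow> 'a \<Rightarrow> 'a" (infixr \<open>*\<^sub>C\<close> 75)
  assumes scaleC_add_right: "a *\<^sub>C (x + y) = a *\<^sub>C x + a *\<^sub>C y"
    and scaleC_add_left: "(a + b) *\<^sub>C x = a *\<^sub>C x + b *\<^sub>C x"
    and scaleC_scaleC: "a *\<^sub>C (b *\<^sub>C x) = (a * b) *\<^sub>C x"
    and scaleC_one: "1 *\<^sub>C x = x"
    and scaleR_scaleC: "scaleR r x = complex_of_real r *\<^sub>C x"

class complex_inner = complex_vector + real_normed_vector +
  fixes cinner :: "'a \<Rightarrow> 'a \<Rightarrow> complex"
  assumes cinner_commute: "cinner x y = cnj (cinner y x)"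
    and cinner_add_right: "cinner x (y + z) = cinner x y + cinner x z"
    and cinner_scaleC_right: "cinner x (r *\<^sub>C y) = r * cinner x y"
    and cinner_ge_zero: "0 \<le> Re (cinner x x)"
    and cinner_eq_zero_iff: "cinner x x = 0 \<longleftrightarrow> x = 0"
    and norm_eq_sqrt_cinner: "norm x = sqrt (Re (cinner x x))"

class chilbert_space = complex_inner + complete_space

definition bounded_clinear_op :: "('h::chilbert_space \<Rightarrow> 'h) \<Rightarrow> bool" where
  "bounded_clinear_op A \<longleftrightarrow>
     (\<forall>x y. A (x + y) = A x + A y) \<and> (\<forall>c x. A (c *\<^sub>C x) = c *\<^sub>C A x) \<and>
     (\<exists>K. \<forall>x. norm (A x) \<le> norm x * K)"

definition positive_op :: "('h::chilbert_space \<Rightarrow> 'h) \<Rightarrow> bool" where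
  "positive_op A \<longleftrightarrow> bounded_clinear_op A \<and>
     (\<forall>x. Im (cinner x (A x)) = 0 \<and> 0 \<le> Re (cinner x (A x)))"

definition op_le :: "('h::chilbert_space \<Rightarrow> 'h) \<Rightarrow> ('h \<Rightarrow> 'h) \<Rightarrow> bool" where
  "op_le A B \<longleftrightarrow> positive_op (\<lambda>z. B z - A z)"

text \<open>Nuclear representation \<open>A z = \<Sum>n \<langle>y n, z\<rangle> x n\<close> with \<open>\<Sum>n \<parallel>x n\<parallel> \<parallel>y n\<parallel> < \<infinity>\<close>.
  On a Hilbert space the operators admitting such a representation are exactly
  the trace-class operators, the trace is \<open>\<Sum>n \<langle>y n, x n\<rangle>\<close> and the trace norm is the
  infimum of \<open>\<Sum>n \<parallel>x n\<parallel> \<parallel>y n\<parallel>\<close> over all representations.\<close>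
definition nuclear_rep :: "('h::chilbert_space \<Rightarrow> 'h) \<Rightarrow> (nat \<Rightarrow> 'h) \<Rightarrow> (nat \<Rightarrow> 'h) \<Rightarrow> bool" where
  "nuclear_rep A x y \<longleftrightarrow> summable (\<lambda>n. norm (x n) * norm (y n)) \<and>
     (\<forall>z. (\<lambda>n. cinner (y n) z *\<^sub>C x n) sums A z)"

definition trace_class :: "('h::chilbert_space \<Rightarrow> 'h) \<Rightarrow> bool" where
  "trace_class A \<longleftrightarrow> bounded_clinear_op A \<and> (\<exists>x y. nuclear_rep A x y)"

definition trace :: "('h::chilbert_space \<Rightarrow> 'h) \<Rightarrow> complex" where
  "trace A = (let (x, y) = (SOME p. nuclear_rep A (fst p) (snd p)) in (\<Sum>n. cinner (y n) (x n)))"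

definition trace_norm :: "('h::chilbert_space \<Rightarrow> 'h) \<Rightarrow> real" where
  "trace_norm A = Inf {(\<Sum>n. norm (x n) * norm (y n)) | x y. nuclear_rep A x y}"

definition Kdelta :: "'a::metric_space set \<Rightarrow> real \<Rightarrow> ('a \<times> 'a) set" where
  "Kdelta K \<delta> = {(\<theta>, \<eta>). \<theta> \<in> K \<and> \<eta> \<in> K \<and> dist \<theta> \<eta> < \<delta>}"

text \<open>\<open>\<omega>_T(K_\<delta>)\<close>, with \<open>inf \<emptyset> = +\<infinity>\<close> (extended reals).\<close>
definition omega :: "('a::metric_space \<Rightarrow> 'h::chilbert_space \<Rightarrow> 'h) \<Rightarrow> 'a set \<Rightarrow> real \<Rightarrow> ereal" where
  "omega T K \<delta> = Inf (ereal ` {trace_norm X | X. trace_class X \<and>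
      (\<forall>(\<theta>, \<eta>) \<in> Kdelta K \<delta>. op_le (\<lambda>z. - X z) (\<lambda>z. T \<theta> z - T \<eta> z) \<and>
                              op_le (\<lambda>z. T \<theta> z - T \<eta> z) X)})"

definition regular :: "'a::metric_space set \<Rightarrow> ('a \<Rightarrow> 'h::chilbert_space \<Rightarrow> 'h) \<Rightarrow> bool" where
  "regular \<Theta> T \<longleftrightarrow> (\<forall>K. compact K \<and> K \<subseteq> \<Theta> \<longrightarrow> ((\<lambda>\<delta>. omega T K \<delta>) \<longlongrightarrow> 0) (at_right 0))"

definition quantum_model :: "'a::metric_space set \<Rightarrow> ('a \<Rightarrow> 'h::chilbert_space \<Rightarrow> 'h) \<Rightarrow> bool" where
  "quantum_model \<Theta> \<rho> \<longleftrightarrow>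
     (\<forall>\<theta>\<in>\<Theta>. positive_op (\<rho> \<theta>) \<and> trace_class (\<rho> \<theta>) \<and> trace (\<rho> \<theta>) = 1) \<and>
     inj_on \<rho> \<Theta> \<and> regular \<Theta> \<rho>"

abbreviation borel_sets_on :: "'b::topological_space set \<Rightarrow> 'b set set" where
  "borel_sets_on U \<equiv> sets (restrict_space borel U)"

definition is_povm :: "'b::metric_space set \<Rightarrow> ('b set \<Rightarrow> 'h::chilbert_space \<Rightarrow> 'h) \<Rightarrow> bool" where
  "is_povm U M \<longleftrightarrow>
     (\<forall>B \<in> borel_sets_on U. positive_op (M B)) \<and>
     (\<forall>Bs::nat \<Rightarrow> 'b set. range Bs \<subseteq> borel_sets_on U \<and> disjoint_family Bs \<longrightarrow>
        (\<forall>x y. (\<lambda>j. cinner x (M (Bs j) y)) sums cinner x (M (\<Union>j. Bs j) y))) \<and>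
     M U = id"

definition Povm :: "'b::metric_space set \<Rightarrow> ('b set \<Rightarrow> 'h::chilbert_space \<Rightarrow> 'h) set" where
  "Povm U = {M. is_povm U M}"

definition povm_measure :: "'b::metric_space set \<Rightarrow> ('h::chilbert_space \<Rightarrow> 'h) \<Rightarrow> ('b set \<Rightarrow> 'h \<Rightarrow> 'h) \<Rightarrow> 'b measure" where
  "povm_measure U T M = measure_of U (borel_sets_on U) (\<lambda>A. ennreal (Re (trace (T \<circ> M A))))"

definition risk :: "'b::metric_space set \<Rightarrow> ('a \<Rightarrow> 'h::chilbert_space \<Rightarrow> 'h) \<Rightarrow> ('a \<times> 'b \<Rightarrow> real) \<Rightarrow>
    ('b set \<Rightarrow> 'h \<Rightarrow> 'h) \<Rightarrow> 'a \<Rightarrow> real" where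
  "risk U \<rho> w M \<theta> = (\<integral>u. w (\<theta>, u) \<partial>(povm_measure U (\<rho> \<theta>) M))"

definition prob_measures :: "'a::metric_space set \<Rightarrow> 'a measure set" where
  "prob_measures \<Theta> = {\<pi>. prob_space \<pi> \<and> sets \<pi> = borel_sets_on \<Theta>}"

end

theory Submission
  imports Defs
begin

text \<open>Regularity of the model makes the risk functions \<open>R\<^sub>M\<close> equicontinuous on \<open>\<Theta>\<close>, uniformly in the
  POVM \<open>M\<close>: if \<open>- X \<le> \<rho> \<theta> - \<rho> \<eta> \<le> X\<close>, the risks at \<open>\<theta>\<close> and \<open>\<eta>\<close> differ by at most
  \<open>sup\<^sub>u |w (\<theta>, u) - w (\<eta>, u)| + sup w \<cdot> Tr X\<close>. Hence, up to \<open>\<epsilon>\<close>, \<open>\<Theta>\<close> may be replaced by a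
  finite net, and since the risk is convex on the convex set of POVMs, separation in finite
  dimension gives a prior supported on the net. No compactness of the set of POVMs is needed.

  Compressions to finite-dimensional subspaces determine \<open>Tr (T M)\<close> in the limit. This makes it
  independent of the nuclear representation of \<open>T\<close> and, by Cholesky elimination in the compressions,
  nonnegative for positive \<open>T\<close> and \<open>M\<close>.\<close>

section \<open>Minimax for finite convexlike families\<close>

definition convexlike :: "'x set \<Rightarrow> 'i set \<Rightarrow> ('x \<Rightarrow> 'i \<Rightarrow> real) \<Rightarrow> bool" where
  "convexlike X I f \<longleftrightarrow>
     (\<forall>x\<in>X. \<forall>y\<in>X. \<forall>t\<in>{0..1}. \<exists>z\<in>X. \<forall>i\<in>I. f z i \<le> t * f x i + (1 - t) * f y i)"

lemma convexlikeI:
  assumes "\<And>x y t. x \<in> X \<Longrightarrow> y \<in> X \<Longrightarrow> 0 \<le> t \<Longrightarrow> t \<le> 1 \<Longrightarrow>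
    \<exists>z\<in>X. \<forall>i\<in>I. f z i \<le> t * f x i + (1 - t) * f y i"
  shows "convexlike X I f"
  using assms unfolding convexlike_def by simp

lemma convexlikeE:
  assumes "convexlike X I f" "x \<in> X" "y \<in> X" "0 \<le> t" "t \<le> 1"
  obtains z where "z \<in> X" "\<And>i. i \<in> I \<Longrightarrow> f z i \<le> t * f x i + (1 - t) * f y i"
  using assms unfolding convexlike_def by (meson atLeastAtMost_iff)

lemma convexlike_subset: "convexlike X I f \<Longrightarrow> J \<subseteq> I \<Longrightarrow> convexlike X J f"
  unfolding convexlike_def by (meson subsetD)

lemma convexlike_sublevel:
  assumes "convexlike X I f" "a \<in> I"
  shows "convexlike {x \<in> X. f x a < v} I f"
proof (rule convexlikeI)
  fix x y and t :: real
  assume x: "x \<in> {x \<in> X. f x a < v}" and y: "y \<in> {x \<in> X. f x a < v}" and t: "0 \<le> t" "t \<le> 1"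
  then obtain z where "z \<in> X" and z_le: "\<And>i. i \<in> I \<Longrightarrow> f z i \<le> t * f x i + (1 - t) * f y i"
    using convexlikeE[OF assms(1), of x y t] by auto
  have "t * f x a + (1 - t) * f y a < v"
    using x y t by (intro convex_bound_lt) auto
  then have "f z a < v"
    using z_le[OF assms(2)] by simp
  then show "\<exists>z\<in>{x \<in> X. f x a < v}. \<forall>i\<in>I. f z i \<le> t * f x i + (1 - t) * f y i"
    using \<open>z \<in> X\<close> z_le by blast
qed

text \<open>In \<open>convexlike X {f, g} (\<lambda>x h. h x)\<close>, the pair of functions \<open>f\<close>, \<open>g\<close> is indexed by itself.\<close>

lemma convexlike_weighted_sum:
  fixes f :: "'x \<Rightarrow> 'i \<Rightarrow> real"
  assumes "convexlike X (insert a I) f" "\<And>i. i \<in> I \<Longrightarrow> 0 \<le> p i"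
  shows "convexlike X {\<lambda>x. f x a, \<lambda>x. \<Sum>i\<in>I. p i * f x i} (\<lambda>x h. h x)"
proof (rule convexlikeI)
  fix x y t assume "x \<in> X" "y \<in> X" and "0 \<le> t" "t \<le> (1::real)"
  then obtain z where "z \<in> X"
    and z_le: "\<And>i. i \<in> insert a I \<Longrightarrow> f z i \<le> t * f x i + (1 - t) * f y i"
    using convexlikeE[OF assms(1)] by blast
  have "(\<Sum>i\<in>I. p i * f z i) \<le> (\<Sum>i\<in>I. p i * (t * f x i + (1 - t) * f y i))"
    using z_le assms(2) by (intro sum_mono mult_left_mono) auto
  also have "\<dots> = t * (\<Sum>i\<in>I. p i * f x i) + (1 - t) * (\<Sum>i\<in>I. p i * f y i)"
    unfolding sum_distrib_left sum.distrib[symmetric] by (simp add: algebra_simps)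
  finally show "\<exists>z\<in>X. \<forall>h\<in>{\<lambda>x. f x a, \<lambda>x. \<Sum>i\<in>I. p i * f x i}. h z \<le> t * h x + (1 - t) * h y"
    using \<open>z \<in> X\<close> z_le by auto
qed

lemma convex_strictly_dominating:
  assumes "convexlike X {f, g} (\<lambda>x h. h x)"
  shows "convex {(r, s). \<exists>x\<in>X. f x < r \<and> g x < s}" (is "convex ?S")
proof (rule convexI)
  fix u u' and t t' :: real
  assume "u \<in> ?S" "u' \<in> ?S" and t: "0 \<le> t" "0 \<le> t'" "t + t' = 1"
  then obtain x r s y r' s' where u: "u = (r, s)" "u' = (r', s')" and "x \<in> X" "y \<in> X"
    and x_less: "f x < r" "g x < s" and y_less: "f y < r'" "g y < s'"
    by blast
  from t have "t' = 1 - t" by simp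
  obtain z where "z \<in> X" and z_le: "\<And>h. h \<in> {f, g} \<Longrightarrow> h z \<le> t * h x + (1 - t) * h y"
    using convexlikeE[OF assms, of x y t] \<open>x \<in> X\<close> \<open>y \<in> X\<close> t by auto
  have combination_less: "t * p + t' * q < t * p' + t' * q'" if "p < p'" "q < q'" for p q p' q'
    using convex_bound_lt[of "p - p'" 0 "q - q'" t t'] that t by (simp add: right_diff_distrib)
  have "f z < t * r + t' * r'" "g z < t * s + t' * s'"
    using z_le[of f] z_le[of g] combination_less[OF x_less(1) y_less(1)]
      combination_less[OF x_less(2) y_less(2)]
    by (auto simp: \<open>t' = 1 - t\<close>)
  then show "t *\<^sub>R u + t' *\<^sub>R u' \<in> ?S"
    using \<open>z \<in> X\<close> u by auto
qed

lemma nonneg_if_affine_bounded_below: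
  fixes p :: real
  assumes "\<And>r. r0 < r \<Longrightarrow> b \<le> p * r"
  shows "0 \<le> p"
proof (rule ccontr)
  assume "\<not> 0 \<le> p"
  then have "p < 0" by simp
  define r where "r = max (r0 + 1) ((b - 1) / p)"
  have "p * r \<le> p * ((b - 1) / p)"
    using \<open>p < 0\<close> by (intro mult_left_mono_neg) (auto simp: r_def)
  moreover have "b \<le> p * r"
    by (rule assms) (simp add: r_def)
  ultimately show False
    using \<open>p < 0\<close> by simp
qed

lemma convexlike_alternative:
  assumes "convexlike X {f, g} (\<lambda>x h. h x)" "X \<noteq> {}"
    and f_or_g_nonneg: "\<And>x. x \<in> X \<Longrightarrow> 0 \<le> f x \<or> 0 \<le> g x"
  obtains p q where "0 \<le> p" "0 \<le> q" "0 < p + q" "\<And>x. x \<in> X \<Longrightarrow> 0 \<le> p * f x + q * g x"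
proof -
  define S where "S = {(r, s). \<exists>x\<in>X. f x < r \<and> g x < s}"
  have "convex S"
    unfolding S_def by (rule convex_strictly_dominating[OF assms(1)])
  moreover have "0 \<notin> S"
    by (auto simp: S_def zero_prod_def dest!: f_or_g_nonneg)
  ultimately obtain p q where "(p, q) \<noteq> 0" and S_nonneg: "\<forall>z\<in>S. 0 \<le> inner (p, q) z"
    by (metis separating_hyperplane_set_0 surj_pair)
  have nonneg: "0 \<le> p * r + q * s" if "x \<in> X" "f x < r" "g x < s" for x r s
    using bspec[OF S_nonneg, of "(r, s)"] that by (auto simp: S_def)
  obtain x0 where "x0 \<in> X"
    using assms(2) by blast
  have "0 \<le> p"
    using nonneg[OF \<open>x0 \<in> X\<close>, of _ "g x0 + 1"]
    by (intro nonneg_if_affine_bounded_below[of "f x0" "- (q * (g x0 + 1))"]) force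
  moreover have "0 \<le> q"
    using nonneg[OF \<open>x0 \<in> X\<close>, of "f x0 + 1"]
    by (intro nonneg_if_affine_bounded_below[of "g x0" "- (p * (f x0 + 1))"]) force
  ultimately have "0 < p + q"
    using \<open>(p, q) \<noteq> 0\<close> by (auto simp: zero_prod_def)
  have "0 \<le> p * f x + q * g x" if "x \<in> X" for x
  proof (rule field_le_epsilon)
    fix e :: real assume "0 < e"
    then have "0 \<le> p * (f x + e / (p + q)) + q * (g x + e / (p + q))"
      using \<open>0 < p + q\<close> by (intro nonneg[OF that]) auto
    also have "\<dots> = p * f x + q * g x + (p + q) * (e / (p + q))"
      by algebra
    finally show "0 \<le> p * f x + q * g x + e"
      using \<open>0 < p + q\<close> by simp
  qed
  with \<open>0 \<le> p\<close> \<open>0 \<le> q\<close> \<open>0 < p + q\<close> show ?thesis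
    by (rule that)
qed

lemma two_function_minimax:
  assumes "convexlike X {f, g} (\<lambda>x h. h x)" and max_ge: "\<And>x. x \<in> X \<Longrightarrow> v \<le> f x \<or> v \<le> g x"
  obtains t where "0 \<le> t" "t \<le> 1" "\<And>x. x \<in> X \<Longrightarrow> v \<le> t * f x + (1 - t) * g x"
proof (cases "X = {}")
  case True
  then show ?thesis using that[of 0] by simp
next
  case False
  have "convexlike X {\<lambda>x. f x - v, \<lambda>x. g x - v} (\<lambda>x h. h x)"
  proof (rule convexlikeI)
    fix x y t assume "x \<in> X" "y \<in> X" "0 \<le> t" "t \<le> (1::real)"
    then obtain z where "z \<in> X" "\<And>h. h \<in> {f, g} \<Longrightarrow> h z \<le> t * h x + (1 - t) * h y"
      using convexlikeE[OF assms(1)] by blast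
    then show "\<exists>z\<in>X. \<forall>h\<in>{\<lambda>x. f x - v, \<lambda>x. g x - v}. h z \<le> t * h x + (1 - t) * h y"
      by (intro bexI[of _ z]) (auto simp: algebra_simps)
  qed
  moreover have "0 \<le> f x - v \<or> 0 \<le> g x - v" if "x \<in> X" for x
    using max_ge[OF that] by simp
  ultimately obtain p q where weights: "0 \<le> p" "0 \<le> q" "0 < p + q"
    and weighted_nonneg: "\<And>x. x \<in> X \<Longrightarrow> 0 \<le> p * (f x - v) + q * (g x - v)"
    using convexlike_alternative[OF _ False] by blast
  have "1 - p / (p + q) = q / (p + q)"
    using weights(3) by (simp add: field_simps)
  have "v \<le> p / (p + q) * f x + (1 - p / (p + q)) * g x" if "x \<in> X" for x
  proof -
    have "v * (p + q) \<le> p * f x + q * g x"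
      using weighted_nonneg[OF that] by (simp add: algebra_simps)
    then have "v \<le> (p * f x + q * g x) / (p + q)"
      using weights(3) by (simp add: pos_le_divide_eq)
    then show ?thesis
      by (simp add: \<open>1 - p / (p + q) = q / (p + q)\<close> add_divide_distrib)
  qed
  then show ?thesis
    using weights by (intro that[of "p / (p + q)"]) auto
qed

text \<open>Kneser's induction: the points where the new function \<open>f _ a\<close> is below \<open>v\<close> form a convexlike
  subfamily, and the weights found there reduce the claim to the two functions \<open>f _ a\<close> and
  \<open>\<Sum>i\<in>G. p i * f _ i\<close>.\<close>

lemma finite_minimax:
  fixes f :: "'x \<Rightarrow> 'i \<Rightarrow> real"
  assumes "finite F" "F \<noteq> {}" "convexlike X F f" "\<And>x. x \<in> X \<Longrightarrow> \<exists>i\<in>F. v \<le> f x i"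
  shows "\<exists>p. (\<forall>i\<in>F. 0 \<le> p i) \<and> sum p F = 1 \<and> (\<forall>x\<in>X. v \<le> (\<Sum>i\<in>F. p i * f x i))"
  using assms
proof (induction F arbitrary: X rule: finite_ne_induct)
  case (singleton i)
  then show ?case by (intro exI[of _ "\<lambda>_. 1"]) auto
next
  case (insert a G)
  have "\<exists>i\<in>G. v \<le> f x i" if "x \<in> {x \<in> X. f x a < v}" for x
    using insert.prems(2)[of x] that by auto
  moreover have "convexlike {x \<in> X. f x a < v} G f"
    using convexlike_sublevel[OF insert.prems(1)] by (auto intro: convexlike_subset)
  ultimately obtain p where p_nonneg: "\<forall>i\<in>G. 0 \<le> p i" and p_sum: "sum p G = 1"
    and p_ge: "\<forall>x\<in>{x \<in> X. f x a < v}. v \<le> (\<Sum>i\<in>G. p i * f x i)"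
    using insert.IH by blast
  have "convexlike X {\<lambda>x. f x a, \<lambda>x. \<Sum>i\<in>G. p i * f x i} (\<lambda>x h. h x)"
    using insert.prems(1) p_nonneg by (intro convexlike_weighted_sum) auto
  moreover have "v \<le> f x a \<or> v \<le> (\<Sum>i\<in>G. p i * f x i)" if "x \<in> X" for x
    using p_ge that by (cases "f x a < v") auto
  ultimately obtain t where t: "0 \<le> t" "t \<le> 1"
    and t_ge: "\<And>x. x \<in> X \<Longrightarrow> v \<le> t * f x a + (1 - t) * (\<Sum>i\<in>G. p i * f x i)"
    by (rule two_function_minimax) blast+
  define q where "q i = (if i = a then t else (1 - t) * p i)" for i
  have q_sum: "(\<Sum>i\<in>insert a G. q i * h i) = t * h a + (1 - t) * (\<Sum>i\<in>G. p i * h i)"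
    for h :: "'i \<Rightarrow> real"
  proof -
    have "(\<Sum>i\<in>G. q i * h i) = (1 - t) * (\<Sum>i\<in>G. p i * h i)"
      unfolding sum_distrib_left using insert.hyps by (intro sum.cong) (auto simp: q_def)
    then show ?thesis
      using insert.hyps by (simp add: q_def)
  qed
  have "\<forall>i\<in>insert a G. 0 \<le> q i"
    using t p_nonneg by (auto simp: q_def)
  moreover have "sum q (insert a G) = 1"
    using q_sum[of "\<lambda>_. 1"] p_sum by simp
  ultimately show ?case
    using q_sum t_ge by auto
qed

section \<open>Integrals\<close>

lemma space_eq_if_sets_eq_borel_sets_on: "sets \<mu> = borel_sets_on S \<Longrightarrow> space \<mu> = S"
  using sets_eq_imp_space_eq[of \<mu> "restrict_space borel S"] by (simp add: space_restrict_space)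

lemma integrable_continuous_on_compact:
  fixes f :: "'a::metric_space \<Rightarrow> real"
  assumes "finite_measure \<mu>" "sets \<mu> = borel_sets_on S" "compact S" "continuous_on S f"
  shows "integrable \<mu> f"
proof -
  interpret finite_measure \<mu> by fact
  obtain C where "\<And>x. x \<in> S \<Longrightarrow> norm (f x) \<le> C"
    using continuous_on_compact_bound[OF assms(3,4)] by blast
  moreover have "f \<in> borel_measurable \<mu>"
    using borel_measurable_continuous_on_restrict[OF assms(4)]
    by (simp add: measurable_cong_sets[OF assms(2) refl])
  ultimately show ?thesis
    using space_eq_if_sets_eq_borel_sets_on[OF assms(2)]
    by (intro integrable_const_bound[of _ C]) auto
qed

lemma nn_integral_le_combination:
  assumes sets: "sets N1 = sets N" "sets N2 = sets N"
    and emeasure_le: "\<And>A. A \<in> sets N \<Longrightarrow> emeasure N A \<le> a * emeasure N1 A + b * emeasure N2 A"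
  shows "(\<integral>\<^sup>+ x. f x \<partial>N) \<le> a * (\<integral>\<^sup>+ x. f x \<partial>N1) + b * (\<integral>\<^sup>+ x. f x \<partial>N2)"
  unfolding nn_integral_def[of N]
proof (rule SUP_least)
  note space = sets[THEN sets_eq_imp_space_eq]
  fix g assume "g \<in> {g. simple_function N g \<and> g \<le> f}"
  then have g: "simple_function N g" "g \<le> f" by auto
  have g_simple: "simple_function N1 g" "simple_function N2 g"
    using g(1) simple_function_cong_algebra[OF sets(1) space(1)]
      simple_function_cong_algebra[OF sets(2) space(2)] by auto
  have "integral\<^sup>S N g \<le> (\<Sum>y\<in>g ` space N. y * (a * emeasure N1 (g -` {y} \<inter> space N) +
      b * emeasure N2 (g -` {y} \<inter> space N)))"
    unfolding simple_integral_def using g(1)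
    by (intro sum_mono mult_left_mono emeasure_le simple_functionD) auto
  also have "\<dots> = a * integral\<^sup>S N1 g + b * integral\<^sup>S N2 g"
    unfolding simple_integral_def space
    by (simp add: sum_distrib_left distrib_left mult.left_commute flip: sum.distrib)
  also have "\<dots> = a * integral\<^sup>N N1 g + b * integral\<^sup>N N2 g"
    using g_simple by (simp add: nn_integral_eq_simple_integral)
  also have "\<dots> \<le> a * integral\<^sup>N N1 f + b * integral\<^sup>N N2 f"
    using g(2) by (intro add_mono mult_left_mono nn_integral_mono) (auto simp: le_fun_def)
  finally show "integral\<^sup>S N g \<le> a * integral\<^sup>N N1 f + b * integral\<^sup>N N2 f" .
qed

lemma integral_le_combination:
  fixes f :: "'a \<Rightarrow> real"
  assumes sets: "sets N1 = sets N" "sets N2 = sets N"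
    and emeasure_le: "\<And>A. A \<in> sets N \<Longrightarrow>
      emeasure N A \<le> ennreal a * emeasure N1 A + ennreal b * emeasure N2 A"
    and integrable: "integrable N1 f" "integrable N2 f"
    and "0 \<le> a" "0 \<le> b" and nonneg: "\<And>x. x \<in> space N \<Longrightarrow> 0 \<le> f x"
  shows "(\<integral>x. f x \<partial>N) \<le> a * (\<integral>x. f x \<partial>N1) + b * (\<integral>x. f x \<partial>N2)"
proof -
  have "f \<in> borel_measurable N"
    using integrable(1) measurable_cong_sets[OF sets(1) refl] by blast
  then have "(\<integral>x. f x \<partial>N) = enn2real (\<integral>\<^sup>+ x. f x \<partial>N)"
    using nonneg by (intro integral_eq_nn_integral) auto
  also have "\<dots> \<le> a * (\<integral>x. f x \<partial>N1) + b * (\<integral>x. f x \<partial>N2)"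
  proof (rule enn2real_leI)
    have nonneg1: "AE x in N1. 0 \<le> f x" and nonneg2: "AE x in N2. 0 \<le> f x"
      using nonneg sets[THEN sets_eq_imp_space_eq] by auto
    then show "0 \<le> a * (\<integral>x. f x \<partial>N1) + b * (\<integral>x. f x \<partial>N2)"
      using assms(6,7) by (simp add: integral_nonneg_AE)
    have "(\<integral>\<^sup>+ x. f x \<partial>N) \<le> ennreal a * (\<integral>\<^sup>+ x. f x \<partial>N1) + ennreal b * (\<integral>\<^sup>+ x. f x \<partial>N2)"
      by (rule nn_integral_le_combination[OF sets emeasure_le])
    then show "(\<integral>\<^sup>+ x. f x \<partial>N) \<le> ennreal (a * (\<integral>x. f x \<partial>N1) + b * (\<integral>x. f x \<partial>N2))"
      using assms(6,7) nonneg1 nonneg2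
      by (simp add: nn_integral_eq_integral integrable integral_nonneg_AE
          flip: ennreal_mult ennreal_plus)
  qed
  finally show ?thesis .
qed

section \<open>Priors\<close>

lemma finite_support_prior:
  fixes \<Theta> :: "'a::metric_space set"
  assumes "finite F" "F \<subseteq> \<Theta>" "\<And>i. i \<in> F \<Longrightarrow> 0 \<le> p i" "sum p F = 1"
  obtains \<pi> where "\<pi> \<in> prob_measures \<Theta>"
    and "\<And>f::'a \<Rightarrow> real. f \<in> borel_measurable (restrict_space borel \<Theta>) \<Longrightarrow>
      (\<integral>\<theta>. f \<theta> \<partial>\<pi>) = (\<Sum>i\<in>F. p i * f i)"
proof -
  let ?P = "point_measure F (\<lambda>i. ennreal (p i))" and ?R = "restrict_space borel \<Theta> :: 'a measure"
  have id_measurable: "(\<lambda>x. x) \<in> measurable ?P ?R"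
    using assms(2)
    by (auto simp: measurable_def space_point_measure sets_point_measure space_restrict_space)
  have "prob_space ?P"
    by (rule prob_spaceI)
      (use assms in \<open>simp add: space_point_measure emeasure_point_measure_finite sum_ennreal\<close>)
  then have "distr ?P ?R (\<lambda>x. x) \<in> prob_measures \<Theta>"
    using prob_space.prob_space_distr[OF _ id_measurable] by (simp add: prob_measures_def)
  moreover have "(\<integral>\<theta>. f \<theta> \<partial>distr ?P ?R (\<lambda>x. x)) = (\<Sum>i\<in>F. p i * f i)"
    if "f \<in> borel_measurable ?R" for f :: "'a \<Rightarrow> real"
    using integral_distr[OF id_measurable that] assms
      lebesgue_integral_point_measure_finite[of F p f] by simp
  ultimately show ?thesis
    by (rule that)
qed

lemma integral_prior_le_SUP:
  fixes f :: "'a::metric_space \<Rightarrow> real"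
  assumes "compact \<Theta>" "\<pi> \<in> prob_measures \<Theta>" "continuous_on \<Theta> f"
  shows "ereal (\<integral>\<theta>. f \<theta> \<partial>\<pi>) \<le> (SUP \<theta>\<in>\<Theta>. ereal (f \<theta>))"
proof -
  interpret prob_space \<pi>
    using assms(2) by (simp add: prob_measures_def)
  have sets: "sets \<pi> = borel_sets_on \<Theta>"
    using assms(2) by (simp add: prob_measures_def)
  then have space: "space \<pi> = \<Theta>"
    by (rule space_eq_if_sets_eq_borel_sets_on)
  then obtain \<theta>max where "\<theta>max \<in> \<Theta>" and f_le: "\<And>\<theta>. \<theta> \<in> \<Theta> \<Longrightarrow> f \<theta> \<le> f \<theta>max"
    using continuous_attains_sup[OF assms(1) _ assms(3)] not_empty by blast
  have "integrable \<pi> f"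
    by (rule integrable_continuous_on_compact[OF finite_measure_axioms sets assms(1,3)])
  then have "(\<integral>\<theta>. f \<theta> \<partial>\<pi>) \<le> f \<theta>max"
    using f_le space by (intro integral_le_const) auto
  then show ?thesis
    using \<open>\<theta>max \<in> \<Theta>\<close> by (intro SUP_upper2[of \<theta>max]) auto
qed

definition uniformly_equicontinuous_on ::
    "'a::metric_space set \<Rightarrow> ('a \<Rightarrow> 'b::metric_space) set \<Rightarrow> bool" where
  "uniformly_equicontinuous_on S \<F> \<longleftrightarrow>
     (\<forall>e>0. \<exists>d>0. \<forall>f\<in>\<F>. \<forall>x\<in>S. \<forall>y\<in>S. dist x y < d \<longrightarrow> dist (f x) (f y) < e)"

lemma uniformly_equicontinuous_on_imp_continuous_on:
  assumes "uniformly_equicontinuous_on S \<F>" "f \<in> \<F>"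
  shows "continuous_on S f"
  using assms unfolding uniformly_equicontinuous_on_def continuous_on_iff by (metis dist_commute)

lemma uniformly_equicontinuous_on_finite_net:
  assumes "uniformly_equicontinuous_on S \<F>" "compact S" "S \<noteq> {}" "0 < e"
  obtains F where "finite F" "F \<noteq> {}" "F \<subseteq> S"
    "\<And>f x. f \<in> \<F> \<Longrightarrow> x \<in> S \<Longrightarrow> \<exists>y\<in>F. dist (f x) (f y) < e"
proof -
  obtain d where "0 < d"
    and f_close: "\<forall>f\<in>\<F>. \<forall>x\<in>S. \<forall>y\<in>S. dist x y < d \<longrightarrow> dist (f x) (f y) < e"
    using assms(1,4) unfolding uniformly_equicontinuous_on_def by blast
  obtain F where F: "finite F" "F \<subseteq> S" "S \<subseteq> (\<Union>y\<in>F. ball y d)"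
    using compactE_image[OF assms(2), of S "\<lambda>y. ball y d"] \<open>0 < d\<close>
    by (metis UN_I centre_in_ball open_ball subsetI)
  have "\<exists>y\<in>F. dist (f x) (f y) < e" if "f \<in> \<F>" "x \<in> S" for f x
  proof -
    obtain y where "y \<in> F" "dist x y < d"
      using F(3) \<open>x \<in> S\<close> by (auto simp: dist_commute)
    then show ?thesis
      using f_close that F(2) by blast
  qed
  moreover have "F \<noteq> {}"
    using F(3) assms(3) by auto
  ultimately show ?thesis
    using F(1,2) that by blast
qed

lemma exists_prior_integral_ge:
  fixes R :: "'x \<Rightarrow> 'a::metric_space \<Rightarrow> real"
  assumes "compact \<Theta>" "\<Theta> \<noteq> {}" "convexlike X \<Theta> R" "uniformly_equicontinuous_on \<Theta> (R ` X)"
    and "v < v'" and max_ge: "\<And>x. x \<in> X \<Longrightarrow> \<exists>\<theta>\<in>\<Theta>. v' \<le> R x \<theta>"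
  obtains \<pi> where "\<pi> \<in> prob_measures \<Theta>" "\<And>x. x \<in> X \<Longrightarrow> v \<le> (\<integral>\<theta>. R x \<theta> \<partial>\<pi>)"
proof -
  obtain F where F: "finite F" "F \<noteq> {}" "F \<subseteq> \<Theta>"
    and net: "\<And>f \<theta>. f \<in> R ` X \<Longrightarrow> \<theta> \<in> \<Theta> \<Longrightarrow> \<exists>\<eta>\<in>F. dist (f \<theta>) (f \<eta>) < v' - v"
    using uniformly_equicontinuous_on_finite_net[OF assms(4,1,2), of "v' - v"] \<open>v < v'\<close> by auto
  have "\<exists>\<eta>\<in>F. v \<le> R x \<eta>" if "x \<in> X" for x
  proof -
    obtain \<theta> where "\<theta> \<in> \<Theta>" "v' \<le> R x \<theta>"
      using max_ge[OF \<open>x \<in> X\<close>] by blast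
    moreover obtain \<eta> where "\<eta> \<in> F" "dist (R x \<theta>) (R x \<eta>) < v' - v"
      using net[OF imageI[OF \<open>x \<in> X\<close>] \<open>\<theta> \<in> \<Theta>\<close>] by blast
    ultimately show ?thesis
      by (intro bexI[of _ \<eta>]) (auto simp: dist_real_def)
  qed
  then obtain p where p: "\<forall>\<eta>\<in>F. 0 \<le> p \<eta>" "sum p F = 1"
    and p_ge: "\<forall>x\<in>X. v \<le> (\<Sum>\<eta>\<in>F. p \<eta> * R x \<eta>)"
    using finite_minimax[OF F(1,2) convexlike_subset[OF assms(3) F(3)]] by blast
  obtain \<pi> where "\<pi> \<in> prob_measures \<Theta>"
    and integral_\<pi>: "\<And>f::'a \<Rightarrow> real. f \<in> borel_measurable (restrict_space borel \<Theta>) \<Longrightarrow>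
        (\<integral>\<theta>. f \<theta> \<partial>\<pi>) = (\<Sum>\<eta>\<in>F. p \<eta> * f \<eta>)"
    using finite_support_prior[OF F(1,3) bspec[OF p(1)] p(2)] by metis
  have "v \<le> (\<integral>\<theta>. R x \<theta> \<partial>\<pi>)" if "x \<in> X" for x
    using integral_\<pi>[of "R x"] p_ge that uniformly_equicontinuous_on_imp_continuous_on[OF assms(4)]
    by (simp add: borel_measurable_continuous_on_restrict)
  with \<open>\<pi> \<in> prob_measures \<Theta>\<close> show ?thesis
    by (rule that)
qed

theorem prior_minimax:
  fixes R :: "'x \<Rightarrow> 'a::metric_space \<Rightarrow> real"
  assumes "compact \<Theta>" "\<Theta> \<noteq> {}" "convexlike X \<Theta> R" "uniformly_equicontinuous_on \<Theta> (R ` X)"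
  shows "(INF x\<in>X. SUP \<theta>\<in>\<Theta>. ereal (R x \<theta>)) =
    (SUP \<pi>\<in>prob_measures \<Theta>. INF x\<in>X. ereal (\<integral>\<theta>. R x \<theta> \<partial>\<pi>))" (is "?minimax = ?maximin")
proof (rule antisym)
  have "ereal (\<integral>\<theta>. R x \<theta> \<partial>\<pi>) \<le> (SUP \<theta>\<in>\<Theta>. ereal (R x \<theta>))"
    if "\<pi> \<in> prob_measures \<Theta>" "x \<in> X" for \<pi> x
    using that assms
    by (intro integral_prior_le_SUP uniformly_equicontinuous_on_imp_continuous_on[OF assms(4)]) auto
  then show "?maximin \<le> ?minimax"
    by (intro SUP_least INF_mono) blast
  show "?minimax \<le> ?maximin"
  proof (rule dense_le)
    fix s assume "s < ?minimax"
    then obtain v' where v': "s < ereal v'" "ereal v' < ?minimax"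
      using ereal_dense2 by blast
    obtain v where v: "s < ereal v" "v < v'"
      using ereal_dense2[OF v'(1)] by auto
    have "\<exists>\<theta>\<in>\<Theta>. v' \<le> R x \<theta>" if "x \<in> X" for x
      using less_INF_D[OF v'(2) that] by (auto simp: less_SUP_iff intro: less_imp_le)
    then obtain \<pi> where \<pi>: "\<pi> \<in> prob_measures \<Theta>" "\<And>x. x \<in> X \<Longrightarrow> v \<le> (\<integral>\<theta>. R x \<theta> \<partial>\<pi>)"
      using exists_prior_integral_ge[OF assms v(2)] by metis
    have "s \<le> ereal v"
      using v(1) by simp
    also have "\<dots> \<le> (INF x\<in>X. ereal (\<integral>\<theta>. R x \<theta> \<partial>\<pi>))"
      using \<pi>(2) by (intro INF_greatest) simp
    also have "\<dots> \<le> ?maximin"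
      using \<pi>(1) by (rule SUP_upper)
    finally show "s \<le> ?maximin" .
  qed
qed

section \<open>Complex inner product spaces\<close>

lemma scaleC_zero_left: "0 *\<^sub>C x = (0::'a::complex_vector)"
  using scaleR_scaleC[of 0 x] by simp

lemma scaleC_minus_left: "(- c) *\<^sub>C x = - (c *\<^sub>C (x::'a::complex_vector))"
  by (metis add_eq_0_iff add.right_inverse scaleC_add_left scaleC_zero_left)

lemma cinner_add_left: "cinner (x + y) z = cinner x z + cinner y (z::'a::complex_inner)"
  by (metis cinner_commute cinner_add_right complex_cnj_add)

lemma cinner_scaleC_left: "cinner (c *\<^sub>C x) y = cnj c * cinner x (y::'a::complex_inner)"
  by (metis cinner_commute cinner_scaleC_right complex_cnj_mult)

lemma cinner_zero_right: "cinner x (0::'a::complex_inner) = 0"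
  using cinner_add_right[of x 0 0] by simp

lemma cinner_zero_left: "cinner 0 (x::'a::complex_inner) = 0"
  using cinner_add_left[of 0 0 x] by simp

lemma cinner_diff_right: "cinner x (y - z) = cinner x y - cinner x (z::'a::complex_inner)"
  using cinner_add_right[of x "y - z" z] by simp

lemma cinner_scaleR_right: "cinner x (r *\<^sub>R y) = r * cinner x (y::'a::complex_inner)"
  by (simp add: scaleR_scaleC cinner_scaleC_right)

lemma cinner_scaleR_left: "cinner (r *\<^sub>R x) y = r * cinner x (y::'a::complex_inner)"
  by (simp add: scaleR_scaleC cinner_scaleC_left)

lemma cinner_sum_right: "cinner x (\<Sum>i\<in>I. f i) = (\<Sum>i\<in>I. cinner x (f i::'a::complex_inner))"
  by (induction I rule: infinite_finite_induct) (auto simp: cinner_add_right cinner_zero_right)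

lemma cinner_sum_left: "cinner (\<Sum>i\<in>I. f i) x = (\<Sum>i\<in>I. cinner (f i) (x::'a::complex_inner))"
  by (induction I rule: infinite_finite_induct) (auto simp: cinner_add_left cinner_zero_left)

lemmas cinner_simps = cinner_add_left cinner_add_right cinner_diff_right
  cinner_scaleC_left cinner_scaleC_right cinner_scaleR_left cinner_scaleR_right
  cinner_zero_left cinner_zero_right

lemma cinner_eq_norm_square: "cinner x x = complex_of_real ((norm (x::'a::complex_inner))\<^sup>2)"
proof -
  have "Im (cinner x x) = 0"
    using cinner_commute[of x x] by (metis Reals_cnj_iff complex_is_Real_iff)
  then show ?thesis
    using norm_eq_sqrt_cinner[of x] cinner_ge_zero[of x] by (simp add: complex_eq_iff)
qed

lemma norm_scaleC: "norm (c *\<^sub>C x) = cmod c * norm (x::'a::complex_inner)"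
proof -
  have "complex_of_real ((norm (c *\<^sub>C x))\<^sup>2) = complex_of_real ((cmod c * norm x)\<^sup>2)"
    unfolding cinner_eq_norm_square[symmetric] cinner_scaleC_left cinner_scaleC_right
    using complex_norm_square[of c] by (simp add: cinner_eq_norm_square power_mult_distrib)
  then show ?thesis
    by (metis of_real_eq_iff power2_eq_iff_nonneg mult_nonneg_nonneg norm_ge_zero)
qed

section \<open>Bounded and positive operators\<close>

lemma bounded_clinear_opI:
  assumes "\<And>x y. A (x + y) = A x + A y" "\<And>c x. A (c *\<^sub>C x) = c *\<^sub>C A x"
    and "\<And>x. norm (A x) \<le> K * norm x"
  shows "bounded_clinear_op A"
  using assms unfolding bounded_clinear_op_def by (metis mult.commute)

lemma bounded_clinear_op_bound:
  assumes "bounded_clinear_op A"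
  obtains K where "0 \<le> K" "\<And>x. norm (A x) \<le> K * norm x"
proof -
  obtain K where norm_A_le: "\<And>x. norm (A x) \<le> norm x * K"
    using assms unfolding bounded_clinear_op_def by blast
  have "norm (A x) \<le> \<bar>K\<bar> * norm x" for x
    using norm_A_le[of x] mult_left_mono[OF abs_ge_self[of K] norm_ge_zero[of x]]
    by (simp add: mult.commute)
  then show ?thesis
    using that[of "\<bar>K\<bar>"] by simp
qed

lemma bounded_clinear_op_add: "bounded_clinear_op A \<Longrightarrow> A (x + y) = A x + A y"
  and bounded_clinear_op_scaleC: "bounded_clinear_op A \<Longrightarrow> A (c *\<^sub>C x) = c *\<^sub>C A x"
  unfolding bounded_clinear_op_def by auto

lemma bounded_clinear_op_zero: "bounded_clinear_op A \<Longrightarrow> A 0 = 0"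
  using bounded_clinear_op_add[of A 0 0] by simp

lemma bounded_clinear_op_sum:
  assumes "bounded_clinear_op A"
  shows "A (\<Sum>i\<in>I. f i) = (\<Sum>i\<in>I. A (f i))"
  using assms
  by (induction I rule: infinite_finite_induct)
    (auto simp: bounded_clinear_op_zero bounded_clinear_op_add)

lemma bounded_clinear_op_id: "bounded_clinear_op (id :: 'h::chilbert_space \<Rightarrow> 'h)"
  by (rule bounded_clinear_opI[where K = 1]) auto

lemma bounded_clinear_op_combination:
  assumes A: "bounded_clinear_op A" and B: "bounded_clinear_op B"
  shows "bounded_clinear_op (\<lambda>z. a *\<^sub>C A z + b *\<^sub>C B z)"
proof -
  obtain K where norm_A_le: "\<And>x. norm (A x) \<le> K * norm x"
    using bounded_clinear_op_bound[OF A] by blast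
  obtain L where norm_B_le: "\<And>x. norm (B x) \<le> L * norm x"
    using bounded_clinear_op_bound[OF B] by blast
  show ?thesis
  proof (rule bounded_clinear_opI)
    show "norm (a *\<^sub>C A z + b *\<^sub>C B z) \<le> (cmod a * K + cmod b * L) * norm z" for z
    proof -
      have "norm (a *\<^sub>C A z + b *\<^sub>C B z) \<le> cmod a * norm (A z) + cmod b * norm (B z)"
        using norm_triangle_ineq[of "a *\<^sub>C A z" "b *\<^sub>C B z"] by (simp add: norm_scaleC)
      also have "\<dots> \<le> cmod a * (K * norm z) + cmod b * (L * norm z)"
        by (intro add_mono mult_left_mono norm_A_le norm_B_le) auto
      finally show ?thesis by (simp add: algebra_simps)
    qed
  qed (simp_all add: A B bounded_clinear_op_add bounded_clinear_op_scaleC scaleC_add_right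
      scaleC_scaleC mult.commute)
qed

lemma positive_opI:
  assumes "bounded_clinear_op A" "\<And>x. Im (cinner x (A x)) = 0" "\<And>x. 0 \<le> Re (cinner x (A x))"
  shows "positive_op A"
  using assms unfolding positive_op_def by blast

lemma
  assumes "positive_op A"
  shows positive_op_bounded_clinear: "bounded_clinear_op A"
    and positive_op_Im: "Im (cinner x (A x)) = 0"
    and positive_op_Re: "0 \<le> Re (cinner x (A x))"
    and positive_op_add: "A (x + y) = A x + A y"
    and positive_op_scaleC: "A (c *\<^sub>C x) = c *\<^sub>C A x"
  using assms unfolding positive_op_def bounded_clinear_op_def by auto

lemma positive_op_quadratic_form:
  "positive_op A \<Longrightarrow> cinner x (A x) = complex_of_real (Re (cinner x (A x)))"
  by (simp add: complex_eq_iff positive_op_Im)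

lemma positive_op_id: "positive_op (id :: 'h::chilbert_space \<Rightarrow> 'h)"
  by (rule positive_opI) (auto simp: bounded_clinear_op_id cinner_eq_norm_square)

lemma positive_op_combination:
  assumes "positive_op A" "positive_op B" "0 \<le> a" "0 \<le> b"
  shows "positive_op (\<lambda>z. a *\<^sub>R A z + b *\<^sub>R B z)"
proof (rule positive_opI)
  show "bounded_clinear_op (\<lambda>z. a *\<^sub>R A z + b *\<^sub>R B z)"
    unfolding scaleR_scaleC
    using assms by (intro bounded_clinear_op_combination positive_op_bounded_clinear)
qed (use assms in \<open>simp_all add: cinner_simps positive_op_Im positive_op_Re\<close>)

lemma positive_op_symmetric:
  assumes "positive_op A"
  shows "cinner (A x) y = cinner x (A y)"
proof -
  note linear = positive_op_add[OF assms] positive_op_scaleC[OF assms]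
  have "Im (cinner x (A y)) + Im (cinner y (A x)) = 0"
    using positive_op_Im[OF assms, of "x + y"] positive_op_Im[OF assms, of x]
      positive_op_Im[OF assms, of y]
    by (simp add: linear cinner_simps)
  moreover have "Re (cinner x (A y)) - Re (cinner y (A x)) = 0"
    using positive_op_Im[OF assms, of "x + \<i> *\<^sub>C y"] positive_op_Im[OF assms, of x]
      positive_op_Im[OF assms, of y]
    by (simp add: linear cinner_simps)
  ultimately have "cinner x (A y) = cnj (cinner y (A x))"
    by (simp add: complex_eq_iff)
  then show ?thesis
    using cinner_commute[of "A x" y] by simp
qed

lemma square_le_mult_if_quadratic_nonneg:
  fixes a b c :: real
  assumes "\<And>t. 0 \<le> a - 2 * t * c\<^sup>2 + t\<^sup>2 * c\<^sup>2 * b" "0 \<le> b"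
  shows "c\<^sup>2 \<le> a * b"
proof (cases "b = 0")
  case True
  have "c = 0"
  proof (rule ccontr)
    assume "c \<noteq> 0"
    then show False
      using assms(1)[of "(a + 1) / (2 * c\<^sup>2)"] True by (simp add: field_simps)
  qed
  then show ?thesis
    using True by simp
next
  case False
  then show ?thesis
    using assms(1)[of "1 / b"] assms(2) by (simp add: field_simps power2_eq_square)
qed

lemma positive_op_Cauchy_Schwarz:
  assumes "positive_op A"
  shows "(cmod (cinner x (A y)))\<^sup>2 \<le> Re (cinner x (A x)) * Re (cinner y (A y))"
proof (rule square_le_mult_if_quadratic_nonneg)
  fix t :: real
  let ?c = "cinner x (A y)"
  let ?s = "- complex_of_real t * cnj ?c"
  have "cinner y (A x) = cnj ?c"
    using positive_op_symmetric[OF assms] cinner_commute by metis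
  then have "cinner (x + ?s *\<^sub>C y) (A (x + ?s *\<^sub>C y)) =
      cinner x (A x) + ?s * ?c + cnj ?s * cnj ?c + cnj ?s * ?s * cinner y (A y)"
    by (simp add: positive_op_add[OF assms] positive_op_scaleC[OF assms] cinner_simps algebra_simps)
  also have "\<dots> = cinner x (A x) - 2 * t * (?c * cnj ?c) + t\<^sup>2 * (?c * cnj ?c) * cinner y (A y)"
    by (simp add: algebra_simps power2_eq_square)
  finally show "0 \<le> Re (cinner x (A x)) - 2 * t * (cmod ?c)\<^sup>2 +
      t\<^sup>2 * (cmod ?c)\<^sup>2 * Re (cinner y (A y))"
    using positive_op_Re[OF assms, of "x + ?s *\<^sub>C y"]
    by (simp flip: complex_norm_square of_real_power of_real_mult)
qed (rule positive_op_Re[OF assms])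

lemma positive_op_eq_0_if_cinner_eq_0:
  assumes "positive_op A" "cinner x (A x) = 0"
  shows "A x = 0"
proof -
  have "cinner (A x) (A x) = 0"
    using positive_op_Cauchy_Schwarz[OF assms(1), of "A x" x] assms(2) by simp
  then show ?thesis
    by (simp add: cinner_eq_zero_iff)
qed

lemma norm_cinner_le: "cmod (cinner x y) \<le> norm x * norm (y::'h::chilbert_space)"
proof -
  have "(cmod (cinner x y))\<^sup>2 \<le> (norm x * norm y)\<^sup>2"
    using positive_op_Cauchy_Schwarz[OF positive_op_id, of x y]
    by (simp add: cinner_eq_norm_square power_mult_distrib)
  then show ?thesis
    by (rule power2_le_imp_le) simp
qed

lemma bounded_clinear_op_form_bound:
  assumes "bounded_clinear_op B"
  shows "\<exists>K\<ge>0. \<forall>x y. cmod (cinner y (B x)) \<le> K * (norm x * norm y)"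
proof -
  obtain K where "0 \<le> K" and norm_B_le: "\<And>x. norm (B x) \<le> K * norm x"
    using bounded_clinear_op_bound[OF assms] by blast
  have "cmod (cinner y (B x)) \<le> K * (norm x * norm y)" for x y
    using norm_cinner_le[of y "B x"] mult_left_mono[OF norm_B_le[of x] norm_ge_zero[of y]]
    by (simp add: algebra_simps)
  with \<open>0 \<le> K\<close> show ?thesis
    by blast
qed

lemma bounded_linear_cinner_right: "bounded_linear (cinner (x::'h::chilbert_space))"
  by (rule bounded_linear_intro[where K = "norm x"])
    (auto simp: cinner_simps scaleR_conv_of_real mult.commute[of _ "norm x"] norm_cinner_le)

lemma bounded_clinear_op_rank_one: "bounded_clinear_op (\<lambda>z. cinner y z *\<^sub>C (x::'h::chilbert_space))"
proof (rule bounded_clinear_opI)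
  show "norm (cinner y z *\<^sub>C x) \<le> (norm y * norm x) * norm z" for z
    using mult_right_mono[OF norm_cinner_le[of y z] norm_ge_zero[of x]]
    by (simp add: norm_scaleC mult_ac)
qed (simp_all add: cinner_simps scaleC_add_left scaleC_scaleC)

text \<open>If \<open>\<langle>a, A a\<rangle> = 0\<close>, then \<open>A a = 0\<close> for positive \<open>A\<close>, so that the division by zero is harmless.\<close>

definition schur_complement :: "('h::chilbert_space \<Rightarrow> 'h) \<Rightarrow> 'h \<Rightarrow> 'h \<Rightarrow> 'h" where
  "schur_complement A a z = A z - (cinner (A a) z / cinner a (A a)) *\<^sub>C A a"

lemma bounded_clinear_op_schur_complement:
  assumes "bounded_clinear_op A"
  shows "bounded_clinear_op (schur_complement A a)"
proof -
  have "schur_complement A a =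
      (\<lambda>z. 1 *\<^sub>C A z + (- 1 / cinner a (A a)) *\<^sub>C (cinner (A a) z *\<^sub>C A a))"
    by (simp add: fun_eq_iff schur_complement_def scaleC_one scaleC_scaleC scaleC_minus_left)
  then show ?thesis
    using bounded_clinear_op_combination[OF assms bounded_clinear_op_rank_one] by simp
qed

lemma positive_op_schur_complement:
  assumes A: "positive_op A"
  shows "positive_op (schur_complement A a)"
proof -
  define d where "d = Re (cinner a (A a))"
  have "0 \<le> d"
    unfolding d_def by (rule positive_op_Re[OF A])
  have "cinner z (schur_complement A a z) =
      complex_of_real (Re (cinner z (A z)) - (cmod (cinner z (A a)))\<^sup>2 / d)" for z
  proof -
    have "cinner a (A a) = complex_of_real d"
      unfolding d_def by (rule positive_op_quadratic_form[OF A])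
    moreover have "cinner (A a) z * cinner z (A a) = complex_of_real ((cmod (cinner z (A a)))\<^sup>2)"
      using cinner_commute[of "A a" z] complex_norm_square[of "cinner z (A a)"]
      by (simp add: mult.commute)
    ultimately show ?thesis
      using positive_op_quadratic_form[OF A, of z] by (simp add: schur_complement_def cinner_simps)
  qed
  moreover have "(cmod (cinner z (A a)))\<^sup>2 / d \<le> Re (cinner z (A z))" for z
    using positive_op_Cauchy_Schwarz[OF A, of z a] \<open>0 \<le> d\<close> positive_op_Re[OF A, of z]
    by (auto simp: divide_le_eq d_def)
  ultimately show ?thesis
    by (intro positive_opI bounded_clinear_op_schur_complement positive_op_bounded_clinear[OF A])
      simp_all
qed

lemma schur_complement_self:
  assumes "positive_op A"
  shows "schur_complement A a a = 0"
proof (cases "cinner a (A a) = 0")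
  case True
  then show ?thesis
    using positive_op_eq_0_if_cinner_eq_0[OF assms]
    by (simp add: schur_complement_def scaleC_zero_left)
next
  case False
  then show ?thesis
    by (simp add: schur_complement_def positive_op_symmetric[OF assms, of a a] scaleC_one)
qed

lemma schur_complement_eq_0:
  assumes "positive_op A" "A e = 0"
  shows "schur_complement A a e = 0"
  using assms positive_op_symmetric[OF assms(1), of a e]
  by (simp add: schur_complement_def cinner_zero_right scaleC_zero_left)

section \<open>Finite orthonormal systems\<close>

definition orthonormal :: "'h::complex_inner set \<Rightarrow> bool" where
  "orthonormal E \<longleftrightarrow> finite E \<and> (\<forall>e\<in>E. \<forall>f\<in>E. cinner e f = (if e = f then 1 else 0))"

definition proj :: "'h::complex_inner set \<Rightarrow> 'h \<Rightarrow> 'h" where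
  "proj E z = (\<Sum>e\<in>E. cinner e z *\<^sub>C e)"

lemma cinner_proj:
  assumes "orthonormal E" "e \<in> E"
  shows "cinner e (proj E z) = cinner e z"
proof -
  have "cinner e (proj E z) = (\<Sum>f\<in>E. if f = e then cinner e z else 0)"
    unfolding proj_def cinner_sum_right cinner_scaleC_right
    using assms by (intro sum.cong) (auto simp: orthonormal_def)
  then show ?thesis
    using assms by (simp add: orthonormal_def)
qed

lemma norm_proj_le:
  fixes z :: "'h::chilbert_space"
  assumes "orthonormal E"
  shows "norm (proj E z) \<le> norm z"
proof -
  have "cinner (proj E z) w = (\<Sum>e\<in>E. cnj (cinner e z) * cinner e w)" for w
    by (simp add: proj_def cinner_sum_left cinner_scaleC_left)
  then have "cinner (proj E z) (proj E z) = cinner (proj E z) z"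
    using cinner_proj[OF assms] by simp
  then have "(norm (proj E z))\<^sup>2 = cmod (cinner (proj E z) z)"
    by (metis cinner_eq_norm_square norm_of_real abs_of_nonneg zero_le_power2)
  also have "\<dots> \<le> norm (proj E z) * norm z"
    by (rule norm_cinner_le)
  finally show ?thesis
    by (cases "proj E z = 0") (simp_all add: power2_eq_square)
qed

lemma orthonormal_insert:
  assumes "orthonormal E" "norm u = 1" "\<And>e. e \<in> E \<Longrightarrow> cinner e u = 0"
  shows "orthonormal (insert u E)"
proof -
  have "cinner u u = 1"
    using assms(2) by (simp add: cinner_eq_norm_square)
  moreover have "cinner u e = 0" if "e \<in> E" for e
    using assms(3)[OF that] cinner_commute[of u e] by simp
  ultimately show ?thesis
    using assms by (auto simp: orthonormal_def)
qed

lemma proj_insert: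
  assumes "orthonormal (insert u E)" "u \<notin> E"
  shows "proj (insert u E) z = cinner u z *\<^sub>C u + proj E z"
  using assms by (simp add: orthonormal_def proj_def)

lemma cinner_proj_eq_0:
  assumes "orthonormal (insert u E)" "u \<notin> E"
  shows "cinner u (proj E z) = 0"
  unfolding proj_def cinner_sum_right cinner_scaleC_right
  using assms by (intro sum.neutral) (auto simp: orthonormal_def)

lemma gram_schmidt_step:
  assumes E: "orthonormal E"
  obtains E' where "orthonormal E'" "proj E' x = x" "\<And>y. proj E y = y \<Longrightarrow> proj E' y = y"
proof (cases "proj E x = x")
  case True
  then show ?thesis using that[OF E] by blast
next
  case False
  define r where "r = x - proj E x"
  define u where "u = (1 / norm r) *\<^sub>R r"
  have "r \<noteq> 0"
    using False by (simp add: r_def)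
  have orthogonal: "cinner e u = 0" if "e \<in> E" for e
    using cinner_proj[OF E that] by (simp add: u_def r_def cinner_simps)
  have "norm u = 1"
    using \<open>r \<noteq> 0\<close> by (simp add: u_def)
  then have E': "orthonormal (insert u E)"
    using orthogonal by (intro orthonormal_insert[OF E])
  have "u \<notin> E"
    using \<open>norm u = 1\<close> orthogonal[of u] by (auto simp: cinner_eq_norm_square)
  note proj_insert = proj_insert[OF E' this] and cinner_proj_eq_0 = cinner_proj_eq_0[OF E' this]
  have "cinner u x = cinner u r"
    by (simp add: r_def cinner_simps cinner_proj_eq_0)
  also have "\<dots> = complex_of_real (norm r)"
    using \<open>r \<noteq> 0\<close> by (simp add: u_def cinner_simps cinner_eq_norm_square power2_eq_square)
  finally have "cinner u x *\<^sub>C u = r"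
    using \<open>r \<noteq> 0\<close> by (simp add: scaleR_scaleC[symmetric] u_def)
  then have "proj (insert u E) x = x"
    by (simp add: proj_insert r_def)
  moreover have "proj (insert u E) y = y" if "proj E y = y" for y
    using cinner_proj_eq_0[of y] that by (simp add: proj_insert scaleC_zero_left)
  ultimately show ?thesis
    by (rule that[OF E'])
qed

lemma finite_orthonormal_span:
  fixes X :: "'h::complex_inner set"
  assumes "finite X"
  obtains E where "orthonormal E" "\<And>x. x \<in> X \<Longrightarrow> proj E x = x"
  using assms
proof (induction X arbitrary: thesis)
  case empty
  show ?case
    by (rule empty[of "{}"]) (simp_all add: orthonormal_def)
next
  case (insert x X)
  obtain E where E: "orthonormal E" "\<And>y. y \<in> X \<Longrightarrow> proj E y = y"
    using insert.IH by blast
  obtain E' where "orthonormal E'" "proj E' x = x" "\<And>y. proj E y = y \<Longrightarrow> proj E' y = y"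
    using gram_schmidt_step[OF E(1)] by blast
  then show ?case
    using E(2) by (intro insert.prems) auto
qed

lemma orthonormal_exhaustion:
  fixes Z :: "(nat \<Rightarrow> 'h::complex_inner) set"
  assumes "finite Z"
  obtains E where "\<And>N. orthonormal (E N)"
    and "\<And>N n z. z \<in> Z \<Longrightarrow> n < N \<Longrightarrow> proj (E N) (z n) = z n"
proof -
  have "\<exists>E. orthonormal E \<and> (\<forall>x\<in>(\<Union>z\<in>Z. z ` {..<N}). proj E x = x)" for N
  proof -
    have "finite (\<Union>z\<in>Z. z ` {..<N})"
      using assms by simp
    then show ?thesis
      by (metis finite_orthonormal_span)
  qed
  then obtain E where "\<And>N. orthonormal (E N) \<and> (\<forall>x\<in>(\<Union>z\<in>Z. z ` {..<N}). proj (E N) x = x)"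
    by metis
  then show ?thesis
    by (intro that[of E]) auto
qed

section \<open>The trace\<close>

text \<open>The trace of the product of the compressions of \<open>A\<close> and \<open>B\<close> to the span of an orthonormal
  \<open>E\<close>.\<close>

definition compr_trace :: "'h::chilbert_space set \<Rightarrow> ('h \<Rightarrow> 'h) \<Rightarrow> ('h \<Rightarrow> 'h) \<Rightarrow> complex" where
  "compr_trace E A B = (\<Sum>e\<in>E. \<Sum>f\<in>E. cinner e (B f) * cinner f (A e))"

lemma compr_trace_diff_left:
  "compr_trace E (\<lambda>z. A z - A' z) B = compr_trace E A B - compr_trace E A' B"
  by (simp add: compr_trace_def cinner_diff_right right_diff_distrib sum_subtractf)

lemma cinner_proj_op_proj:
  assumes "bounded_clinear_op B"
  shows "cinner (proj E y) (B (proj E x)) =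
    (\<Sum>e\<in>E. \<Sum>f\<in>E. cinner e (B f) * (cinner y e * cinner f x))"
proof -
  have "B (proj E x) = (\<Sum>f\<in>E. cinner f x *\<^sub>C B f)"
    by (simp add: proj_def bounded_clinear_op_sum[OF assms] bounded_clinear_op_scaleC[OF assms])
  moreover have "cnj (cinner e y) = cinner y e" for e
    using cinner_commute[of y e] by simp
  ultimately show ?thesis
    by (subst sum.swap)
      (simp add: proj_def cinner_sum_left cinner_sum_right cinner_simps sum_distrib_left
        algebra_simps)
qed

lemma compr_trace_schur_complement:
  assumes "bounded_clinear_op B"
  shows "compr_trace E A B = compr_trace E (schur_complement A a) B +
    cinner (proj E (A a)) (B (proj E (A a))) / cinner a (A a)"
proof -
  have "cinner e (B f) * cinner f (A e) = cinner e (B f) * cinner f (schur_complement A a e) +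
      cinner e (B f) * (cinner (A a) e * cinner f (A a)) / cinner a (A a)" for e f
    by (simp add: schur_complement_def cinner_simps right_diff_distrib)
  then show ?thesis
    unfolding cinner_proj_op_proj[OF assms] compr_trace_def
    by (simp only: sum_divide_distrib sum.distrib)
qed

text \<open>Cholesky elimination: each step splits off a positive rank-one operator, for which the claim
  is positivity of \<open>B\<close>, and annihilates one more vector of \<open>E\<close>.\<close>

lemma compr_trace_nonneg:
  assumes "finite E" "positive_op A" "positive_op B"
  shows "0 \<le> Re (compr_trace E A B)"
proof -
  have "0 \<le> Re (compr_trace E A B)"
    if "finite F" "positive_op A" "\<And>e. e \<in> E - F \<Longrightarrow> A e = 0" for F A
    using that
  proof (induction F arbitrary: A)
    case empty
    then show ?case
      by (simp add: compr_trace_def cinner_zero_right)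
  next
    case (insert a F)
    let ?v = "proj E (A a)"
    have "0 \<le> Re (compr_trace E (schur_complement A a) B)"
    proof (rule insert.IH)
      show "positive_op (schur_complement A a)"
        using insert.prems(1) by (rule positive_op_schur_complement)
      show "schur_complement A a e = 0" if "e \<in> E - F" for e
        using that insert.prems
        by (cases "e = a") (auto simp: schur_complement_self schur_complement_eq_0)
    qed
    moreover have "0 \<le> Re (cinner ?v (B ?v) / cinner a (A a))"
      using positive_op_Re[OF insert.prems(1), of a] positive_op_Re[OF assms(3), of ?v]
        positive_op_quadratic_form[OF insert.prems(1), of a]
      by (metis Re_divide_of_real divide_nonneg_nonneg)
    ultimately show ?case
      by (simp add: positive_op_bounded_clinear[OF assms(3)]
          compr_trace_schur_complement[of B E A a])
  qed
  from this[OF assms(1,2)] show ?thesis by simp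
qed

lemma nuclear_rep_summable_norm:
  "nuclear_rep A x y \<Longrightarrow> summable (\<lambda>n. K * (norm (x n) * norm (y n)))"
  unfolding nuclear_rep_def by (intro summable_mult) simp

lemma nuclear_rep_summable_cinner:
  assumes "nuclear_rep A x y" "bounded_clinear_op B"
  shows "summable (\<lambda>n. cinner (y n) (B (x n)))"
proof -
  obtain K where "\<forall>u v. cmod (cinner v (B u)) \<le> K * (norm u * norm v)"
    using bounded_clinear_op_form_bound[OF assms(2)] by blast
  then have "norm (cinner (y n) (B (x n))) \<le> K * (norm (x n) * norm (y n))" for n
    by simp
  with nuclear_rep_summable_norm[OF assms(1)] show ?thesis
    by (rule summable_comparison_test')
qed

lemma nuclear_rep_compr_trace_sums:
  assumes "nuclear_rep A x y" "bounded_clinear_op B"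
  shows "(\<lambda>n. cinner (proj E (y n)) (B (proj E (x n)))) sums compr_trace E A B"
proof -
  have "(\<lambda>n. cinner (y n) e * cinner f (x n)) sums cinner f (A e)" for e f
    using bounded_linear.sums[OF bounded_linear_cinner_right[of f],
        of "\<lambda>n. cinner (y n) e *\<^sub>C x n" "A e"] assms(1)
    by (simp add: nuclear_rep_def cinner_simps)
  then show ?thesis
    unfolding cinner_proj_op_proj[OF assms(2)] compr_trace_def by (intro sums_sum sums_mult)
qed

lemma compr_trace_tendsto:
  assumes rep: "nuclear_rep A x y" and B: "bounded_clinear_op B"
    and orthonormal_E: "\<And>N. orthonormal (E N)"
    and proj_x: "\<And>N n. n < N \<Longrightarrow> proj (E N) (x n) = x n"
    and proj_y: "\<And>N n. n < N \<Longrightarrow> proj (E N) (y n) = y n"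
  shows "(\<lambda>N. compr_trace (E N) A B) \<longlonglongrightarrow> (\<Sum>n. cinner (y n) (B (x n)))"
proof -
  obtain K where "0 \<le> K" and B_le: "\<forall>u v. cmod (cinner v (B u)) \<le> K * (norm u * norm v)"
    using bounded_clinear_op_form_bound[OF B] by blast
  let ?a = "\<lambda>n N. cinner (proj (E N) (y n)) (B (proj (E N) (x n)))"
  have bound: "norm (?a n N) \<le> K * (norm (x n) * norm (y n))" for n N
  proof -
    have "norm (?a n N) \<le> K * (norm (proj (E N) (x n)) * norm (proj (E N) (y n)))"
      using B_le by blast
    also have "\<dots> \<le> K * (norm (x n) * norm (y n))"
      using \<open>0 \<le> K\<close> norm_proj_le[OF orthonormal_E] by (intro mult_left_mono mult_mono) auto
    finally show ?thesis .
  qed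
  have "(\<lambda>N. \<Sum>n. ?a n N) \<longlonglongrightarrow> (\<Sum>n. cinner (y n) (B (x n)))"
  proof (rule tannerys_theorem[THEN conjunct2, THEN conjunct2])
    show "(\<lambda>N. ?a n N) \<longlonglongrightarrow> cinner (y n) (B (x n))" for n
      by (rule tendsto_eventually)
        (use proj_x proj_y in \<open>auto intro!: eventually_sequentiallyI[of "Suc n"]\<close>)
    show "summable (\<lambda>n. K * (norm (x n) * norm (y n)))"
      by (rule nuclear_rep_summable_norm[OF rep])
  qed (auto intro!: always_eventually bound)
  then show ?thesis
    using sums_unique[OF nuclear_rep_compr_trace_sums[OF rep B]] by simp
qed

lemma trace_eq_suminf:
  assumes "nuclear_rep A x y"
  shows "trace A = (\<Sum>n. cinner (y n) (x n))"
proof -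
  define p where "p = (SOME p. nuclear_rep A (fst p) (snd p))"
  have rep_p: "nuclear_rep A (fst p) (snd p)"
    unfolding p_def by (rule someI[of _ "(x, y)"]) (simp add: assms)
  obtain E where orthonormal_E: "\<And>N. orthonormal (E N)"
    and proj_E: "\<And>N n z. z \<in> {x, y, fst p, snd p} \<Longrightarrow> n < N \<Longrightarrow> proj (E N) (z n) = z n"
    using orthonormal_exhaustion[of "{x, y, fst p, snd p}"] by auto
  have "(\<lambda>N. compr_trace (E N) A id) \<longlonglongrightarrow> (\<Sum>n. cinner (y n) (id (x n)))"
    by (rule compr_trace_tendsto[OF assms bounded_clinear_op_id orthonormal_E]) (auto intro: proj_E)
  moreover have "(\<lambda>N. compr_trace (E N) A id) \<longlonglongrightarrow> (\<Sum>n. cinner (snd p n) (id (fst p n)))"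
    by (rule compr_trace_tendsto[OF rep_p bounded_clinear_op_id orthonormal_E]) (auto intro: proj_E)
  ultimately have "(\<Sum>n. cinner (y n) (x n)) = (\<Sum>n. cinner (snd p n) (fst p n))"
    using LIMSEQ_unique by auto
  then show ?thesis
    unfolding trace_def p_def[symmetric] by (simp add: case_prod_beta)
qed

lemma nuclear_rep_comp:
  assumes rep: "nuclear_rep A x y" and "bounded_clinear_op C"
    and adjoint: "\<And>u v. cinner (C u) v = cinner u (B v)"
  shows "nuclear_rep (A \<circ> B) x (\<lambda>n. C (y n))"
proof -
  obtain K where norm_C_le: "\<And>x. norm (C x) \<le> K * norm x"
    using bounded_clinear_op_bound[OF assms(2)] by blast
  have "summable (\<lambda>n. norm (x n) * norm (C (y n)))"
  proof (rule summable_comparison_test')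
    show "summable (\<lambda>n. K * (norm (x n) * norm (y n)))"
      by (rule nuclear_rep_summable_norm[OF rep])
    show "norm (norm (x n) * norm (C (y n))) \<le> K * (norm (x n) * norm (y n))" for n
      using mult_left_mono[OF norm_C_le[of "y n"] norm_ge_zero[of "x n"]] by (simp add: algebra_simps)
  qed
  then show ?thesis
    using rep by (simp add: nuclear_rep_def adjoint)
qed

lemma trace_comp_eq_suminf:
  assumes "nuclear_rep A x y" "positive_op B"
  shows "trace (A \<circ> B) = (\<Sum>n. cinner (y n) (B (x n)))"
  using trace_eq_suminf[OF nuclear_rep_comp[OF assms(1) positive_op_bounded_clinear[OF assms(2)]
        positive_op_symmetric[OF assms(2)]]]
  by (simp add: positive_op_symmetric[OF assms(2)])

lemma trace_class_nuclear_rep: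
  assumes "trace_class A"
  obtains x y where "nuclear_rep A x y"
  using assms unfolding trace_class_def by blast

lemma compr_trace_exhaustion:
  assumes "finite \<T>" "\<And>T. T \<in> \<T> \<Longrightarrow> trace_class T"
  obtains E where "\<And>N. orthonormal (E N)"
    "\<And>T B. T \<in> \<T> \<Longrightarrow> positive_op B \<Longrightarrow> (\<lambda>N. compr_trace (E N) T B) \<longlonglongrightarrow> trace (T \<circ> B)"
proof -
  obtain x y where rep: "\<And>T. T \<in> \<T> \<Longrightarrow> nuclear_rep T (x T) (y T)"
    using assms(2) unfolding trace_class_def by metis
  obtain E where orthonormal_E: "\<And>N. orthonormal (E N)"
    and proj_E: "\<And>N n z. z \<in> x ` \<T> \<union> y ` \<T> \<Longrightarrow> n < N \<Longrightarrow> proj (E N) (z n) = z n"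
    using orthonormal_exhaustion[of "x ` \<T> \<union> y ` \<T>"] assms(1) by blast
  have "(\<lambda>N. compr_trace (E N) T B) \<longlonglongrightarrow> trace (T \<circ> B)" if "T \<in> \<T>" "positive_op B" for T B
    unfolding trace_comp_eq_suminf[OF rep[OF that(1)] that(2)]
    using that
    by (intro compr_trace_tendsto rep positive_op_bounded_clinear orthonormal_E proj_E) auto
  with orthonormal_E show ?thesis
    by (rule that)
qed

lemma trace_comp_le:
  assumes "trace_class S" "trace_class T" "trace_class X"
    and le_X: "op_le (\<lambda>z. S z - T z) X" and B: "positive_op B"
  shows "Re (trace (S \<circ> B)) \<le> Re (trace (T \<circ> B)) + Re (trace (X \<circ> B))"
proof (rule compr_trace_exhaustion[of "{S, T, X}"])
  show "finite {S, T, X}" by simp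
  show "trace_class A" if "A \<in> {S, T, X}" for A
    using that assms(1-3) by auto
  fix E
  assume orthonormal_E: "orthonormal (E N)"
    and lim: "A \<in> {S, T, X} \<Longrightarrow> positive_op B \<Longrightarrow>
      (\<lambda>N. compr_trace (E N) A B) \<longlonglongrightarrow> trace (A \<circ> B)" for N :: nat and A B
  show ?thesis
  proof (rule LIMSEQ_le)
    show "(\<lambda>N. Re (compr_trace (E N) S B)) \<longlonglongrightarrow> Re (trace (S \<circ> B))"
      by (intro tendsto_Re lim B) simp
    show "(\<lambda>N. Re (compr_trace (E N) T B) + Re (compr_trace (E N) X B)) \<longlonglongrightarrow>
        Re (trace (T \<circ> B)) + Re (trace (X \<circ> B))"
      by (intro tendsto_add tendsto_Re lim B) simp_all
    have difference_nonneg: "0 \<le> Re (compr_trace (E N) (\<lambda>z. X z - (S z - T z)) B)" for N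
      using orthonormal_E[of N] le_X B
      by (intro compr_trace_nonneg) (simp_all add: orthonormal_def op_le_def)
    have "Re (compr_trace (E N) S B) \<le>
        Re (compr_trace (E N) T B) + Re (compr_trace (E N) X B)" for N
      using difference_nonneg[of N] by (simp add: compr_trace_diff_left)
    then show "\<exists>n0. \<forall>N\<ge>n0. Re (compr_trace (E N) S B) \<le>
        Re (compr_trace (E N) T B) + Re (compr_trace (E N) X B)"
      by blast
  qed
qed

lemma trace_comp_nonneg:
  assumes "trace_class T" "positive_op T" "positive_op B"
  shows "0 \<le> Re (trace (T \<circ> B))"
  using trace_comp_le[of T T T B] assms by (simp add: op_le_def)

lemma trace_comp_combination:
  assumes T: "trace_class T" and A: "positive_op A" and B: "positive_op B" and "0 \<le> a" "0 \<le> b"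
  shows "trace (T \<circ> (\<lambda>z. a *\<^sub>R A z + b *\<^sub>R B z)) = a * trace (T \<circ> A) + b * trace (T \<circ> B)"
proof -
  obtain x y where rep: "nuclear_rep T x y"
    using T by (rule trace_class_nuclear_rep)
  have "trace (T \<circ> (\<lambda>z. a *\<^sub>R A z + b *\<^sub>R B z)) =
      (\<Sum>n. complex_of_real a * cinner (y n) (A (x n)) + complex_of_real b * cinner (y n) (B (x n)))"
    unfolding trace_comp_eq_suminf[OF rep positive_op_combination[OF assms(2-)]]
    by (simp add: cinner_simps)
  also have "\<dots> = a * trace (T \<circ> A) + b * trace (T \<circ> B)"
    using nuclear_rep_summable_cinner[OF rep, of A] nuclear_rep_summable_cinner[OF rep, of B] A B
    by (simp add: trace_comp_eq_suminf[OF rep] positive_op_bounded_clinear suminf_add[symmetric]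
        suminf_mult summable_mult)
  finally show ?thesis .
qed

lemma norm_trace_le_trace_norm:
  assumes "trace_class X"
  shows "cmod (trace X) \<le> trace_norm X"
  unfolding trace_norm_def
proof (rule cInf_greatest)
  show "{(\<Sum>n. norm (x n) * norm (y n)) | x y. nuclear_rep X x y} \<noteq> {}"
    using assms unfolding trace_class_def by blast
  fix s assume "s \<in> {(\<Sum>n. norm (x n) * norm (y n)) | x y. nuclear_rep X x y}"
  then obtain x y where s: "s = (\<Sum>n. norm (x n) * norm (y n))" and rep: "nuclear_rep X x y"
    by blast
  have "norm (cinner (y n) (x n)) \<le> norm (x n) * norm (y n)" for n
    using norm_cinner_le[of "y n" "x n"] by (simp add: mult.commute)
  then show "cmod (trace X) \<le> s"
    unfolding s trace_eq_suminf[OF rep]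
    using rep by (intro norm_suminf_le) (simp_all add: nuclear_rep_def)
qed

section \<open>Operator-valued measures\<close>

lemma top_in_borel_sets_on: "U \<in> borel_sets_on U"
  using sets.top[of "restrict_space borel U"] by (simp add: space_restrict_space)

lemma sigma_algebra_borel_sets_on: "sigma_algebra U (borel_sets_on U)"
  using sets.sigma_algebra_axioms[of "restrict_space borel U"] by (simp add: space_restrict_space)

lemma povm_positive: "is_povm U M \<Longrightarrow> A \<in> borel_sets_on U \<Longrightarrow> positive_op (M A)"
  and povm_total: "is_povm U M \<Longrightarrow> M U = id"
  unfolding is_povm_def by blast+

lemma povm_sums:
  assumes "is_povm U M" "range Bs \<subseteq> borel_sets_on U" "disjoint_family Bs"
  shows "(\<lambda>j. cinner x (M (Bs j) y)) sums cinner x (M (\<Union>j. Bs j) y)"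
  using assms unfolding is_povm_def by blast

lemma cinner_povm_empty:
  assumes "is_povm U M"
  shows "cinner x (M {} y) = 0"
proof -
  have "(\<lambda>j::nat. cinner x (M {} y)) sums cinner x (M (\<Union>j::nat. {}) y)"
    by (rule povm_sums[OF assms]) (auto simp: disjoint_family_on_def)
  then show ?thesis
    using sums_summable summable_const_iff by blast
qed

lemma cinner_povm_Un:
  assumes "is_povm U M" "A \<in> borel_sets_on U" "B \<in> borel_sets_on U" "A \<inter> B = {}"
  shows "cinner x (M (A \<union> B) y) = cinner x (M A y) + cinner x (M B y)"
proof -
  have "disjoint_family (binaryset A B)"
    using assms(4) by (auto simp: disjoint_family_on_def binaryset_def)
  then have "(\<lambda>j. cinner x (M (binaryset A B j) y)) sums cinner x (M (\<Union>j. binaryset A B j) y)"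
    using assms(2,3) by (intro povm_sums[OF assms(1)]) (auto simp: range_binaryset_eq)
  moreover have "(\<lambda>j. cinner x (M (binaryset A B j) y)) sums (cinner x (M A y) + cinner x (M B y))"
    by (rule binaryset_sums) (rule cinner_povm_empty[OF assms(1)])
  ultimately show ?thesis
    unfolding UN_binaryset_eq by (rule sums_unique2)
qed

lemma cinner_povm_UN_lessThan:
  fixes J :: nat
  assumes "is_povm U M" "range Bs \<subseteq> borel_sets_on U" "disjoint_family Bs"
  shows "cinner x (M (\<Union>j<J. Bs j) y) = (\<Sum>j<J. cinner x (M (Bs j) y))"
proof (induction J)
  case 0
  show ?case by (simp add: cinner_povm_empty[OF assms(1)])
next
  case (Suc J)
  have "Bs J \<inter> Bs j = {}" if "j < J" for j
    using disjoint_family_onD[OF assms(3)] that by auto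
  then have "Bs J \<inter> (\<Union>j<J. Bs j) = {}" by auto
  moreover have "Bs j \<in> borel_sets_on U" for j
    using assms(2) by auto
  ultimately have "cinner x (M (Bs J \<union> (\<Union>j<J. Bs j)) y) =
      cinner x (M (Bs J) y) + cinner x (M (\<Union>j<J. Bs j) y)"
    by (intro cinner_povm_Un[OF assms(1)]) auto
  then show ?case
    using Suc by (simp add: lessThan_Suc add.commute)
qed

lemma Re_cinner_povm_le:
  assumes M: "is_povm U M" and A: "A \<in> borel_sets_on U"
  shows "Re (cinner z (M A z)) \<le> (norm z)\<^sup>2"
proof -
  have complement: "U - A \<in> borel_sets_on U"
    using top_in_borel_sets_on A by (rule sets.Diff)
  have "A \<union> (U - A) = U"
    using sets.sets_into_space[OF A] by (auto simp: space_restrict_space)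
  then have "cinner z z = cinner z (M A z) + cinner z (M (U - A) z)"
    using cinner_povm_Un[OF M A complement, of z z] by (simp add: povm_total[OF M])
  moreover have "0 \<le> Re (cinner z (M (U - A) z))"
    by (rule positive_op_Re[OF povm_positive[OF M complement]])
  ultimately show ?thesis
    using cinner_eq_norm_square[of z]
    by (metis Re_complex_of_real plus_complex.sel(1) le_add_same_cancel1)
qed

lemma norm_cinner_povm_le:
  assumes M: "is_povm U M" and A: "A \<in> borel_sets_on U"
  shows "cmod (cinner x (M A y)) \<le> norm x * norm y"
proof -
  note positive = povm_positive[OF M A]
  have "(cmod (cinner x (M A y)))\<^sup>2 \<le> Re (cinner x (M A x)) * Re (cinner y (M A y))"
    by (rule positive_op_Cauchy_Schwarz[OF positive])
  also have "\<dots> \<le> (norm x)\<^sup>2 * (norm y)\<^sup>2"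
    using positive_op_Re[OF positive] by (intro mult_mono Re_cinner_povm_le[OF M A]) auto
  finally have "(cmod (cinner x (M A y)))\<^sup>2 \<le> (norm x * norm y)\<^sup>2"
    by (simp add: power_mult_distrib)
  then show ?thesis
    by (rule power2_le_imp_le) simp
qed

lemma trace_comp_povm_sums:
  assumes M: "is_povm U M" and T: "trace_class T"
    and Bs: "range Bs \<subseteq> borel_sets_on U" "disjoint_family Bs"
  shows "(\<lambda>j. trace (T \<circ> M (Bs j))) sums trace (T \<circ> M (\<Union>j. Bs j))"
proof -
  obtain x y where rep: "nuclear_rep T x y"
    using T by (rule trace_class_nuclear_rep)
  have sets: "Bs j \<in> borel_sets_on U" "(\<Union>j\<in>J. Bs j) \<in> borel_sets_on U" for j J
    using Bs(1) by auto
  have "(\<lambda>J. \<Sum>n. \<Sum>j<J. cinner (y n) (M (Bs j) (x n))) \<longlonglongrightarrow>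
      (\<Sum>n. cinner (y n) (M (\<Union>j. Bs j) (x n)))"
  proof (rule tannerys_theorem[THEN conjunct2, THEN conjunct2])
    show "(\<lambda>J. \<Sum>j<J. cinner (y n) (M (Bs j) (x n))) \<longlonglongrightarrow> cinner (y n) (M (\<Union>j. Bs j) (x n))" for n
      using povm_sums[OF M Bs] unfolding sums_def .
    show "summable (\<lambda>n. norm (x n) * norm (y n))"
      using rep by (simp add: nuclear_rep_def)
    have "norm (cinner (y n) (M (\<Union>j<J. Bs j) (x n))) \<le> norm (x n) * norm (y n)" for n J
      using norm_cinner_povm_le[OF M sets(2), of "y n" _ "x n"] by (simp add: mult.commute)
    then show "\<forall>\<^sub>F (n, J) in sequentially \<times>\<^sub>F sequentially.
        norm (\<Sum>j<J. cinner (y n) (M (Bs j) (x n))) \<le> norm (x n) * norm (y n)"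
      unfolding cinner_povm_UN_lessThan[OF M Bs] by (auto intro!: always_eventually)
  qed simp
  moreover have "(\<Sum>n. \<Sum>j<J. cinner (y n) (M (Bs j) (x n))) = (\<Sum>j<J. trace (T \<circ> M (Bs j)))" for J
    unfolding trace_comp_eq_suminf[OF rep povm_positive[OF M sets(1)]]
    by (intro suminf_sum nuclear_rep_summable_cinner[OF rep] positive_op_bounded_clinear
        povm_positive[OF M sets(1)])
  ultimately show ?thesis
    unfolding sums_def trace_comp_eq_suminf[OF rep povm_positive[OF M sets(2)]] by simp
qed

definition povm_mixture ::
    "real \<Rightarrow> ('b set \<Rightarrow> 'h \<Rightarrow> 'h) \<Rightarrow> ('b set \<Rightarrow> 'h \<Rightarrow> 'h) \<Rightarrow> 'b set \<Rightarrow> 'h::chilbert_space \<Rightarrow> 'h" where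
  "povm_mixture t M N A z = t *\<^sub>R M A z + (1 - t) *\<^sub>R N A z"

lemma is_povm_mixture:
  assumes "is_povm U M" "is_povm U N" "0 \<le> t" "t \<le> 1"
  shows "is_povm U (povm_mixture t M N)"
  unfolding is_povm_def
proof (intro conjI ballI allI impI)
  show "positive_op (povm_mixture t M N B)" if "B \<in> borel_sets_on U" for B
    unfolding povm_mixture_def
    using assms that by (intro positive_op_combination povm_positive) auto
  show "(\<lambda>j. cinner x (povm_mixture t M N (Bs j) y)) sums
      cinner x (povm_mixture t M N (\<Union>j. Bs j) y)"
    if "range Bs \<subseteq> borel_sets_on U \<and> disjoint_family Bs" for Bs :: "nat \<Rightarrow> _" and x y
    unfolding povm_mixture_def cinner_add_right cinner_scaleR_right
    using that by (intro sums_add sums_mult povm_sums[OF assms(1)] povm_sums[OF assms(2)]) auto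
  show "povm_mixture t M N U = id"
    using assms by (simp add: povm_mixture_def povm_total fun_eq_iff flip: scaleR_add_left)
qed

section \<open>Outcome distributions\<close>

lemma sets_povm_measure: "sets (povm_measure U T M) = borel_sets_on U"
  unfolding povm_measure_def
  by (rule sigma_algebra.sets_measure_of_eq[OF sigma_algebra_borel_sets_on])

lemma space_povm_measure: "space (povm_measure U T M) = U"
  by (rule space_eq_if_sets_eq_borel_sets_on[OF sets_povm_measure])

lemma emeasure_povm_measure:
  assumes M: "is_povm U M" and T: "trace_class T" "positive_op T" and A: "A \<in> borel_sets_on U"
  shows "emeasure (povm_measure U T M) A = ennreal (Re (trace (T \<circ> M A)))"
  unfolding povm_measure_def
proof (rule emeasure_measure_of_sigma[OF sigma_algebra_borel_sets_on _ _ A])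
  obtain x y where rep: "nuclear_rep T x y"
    using T(1) by (rule trace_class_nuclear_rep)
  have "trace (T \<circ> M {}) = 0"
    using trace_comp_eq_suminf[OF rep povm_positive[OF M, of "{}"]] cinner_povm_empty[OF M] by simp
  then show "positive (borel_sets_on U) (\<lambda>A. ennreal (Re (trace (T \<circ> M A))))"
    by (simp add: positive_def)
  show "countably_additive (borel_sets_on U) (\<lambda>A. ennreal (Re (trace (T \<circ> M A))))"
  proof (rule countably_additiveI)
    fix Bs :: "nat \<Rightarrow> _"
    assume Bs: "range Bs \<subseteq> borel_sets_on U" "disjoint_family Bs"
    show "(\<Sum>i. ennreal (Re (trace (T \<circ> M (Bs i))))) = ennreal (Re (trace (T \<circ> M (\<Union>i. Bs i))))"
    proof (rule suminf_ennreal_eq)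
      show "0 \<le> Re (trace (T \<circ> M (Bs i)))" for i
        using Bs(1) by (intro trace_comp_nonneg[OF T] povm_positive[OF M]) auto
      show "(\<lambda>i. Re (trace (T \<circ> M (Bs i)))) sums Re (trace (T \<circ> M (\<Union>i. Bs i)))"
        by (rule sums_Re[OF trace_comp_povm_sums[OF M T(1) Bs]])
    qed
  qed
qed

lemma finite_measure_povm_measure:
  assumes "is_povm U M" "trace_class T" "positive_op T"
  shows "finite_measure (povm_measure U T M)"
  by (rule finite_measureI)
    (simp add: space_povm_measure emeasure_povm_measure[OF assms top_in_borel_sets_on])

lemma measure_povm_measure_space:
  assumes "is_povm U M" "trace_class T" "positive_op T"
  shows "measure (povm_measure U T M) U = Re (trace T)"
proof -
  have "0 \<le> Re (trace T)"
    using trace_comp_nonneg[OF assms(2,3) positive_op_id] by simp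
  then show ?thesis
    by (simp add: measure_def emeasure_povm_measure[OF assms top_in_borel_sets_on]
        povm_total[OF assms(1)])
qed

lemma integrable_povm_measure:
  fixes f :: "'b::metric_space \<Rightarrow> real"
  assumes "is_povm U M" "trace_class T" "positive_op T" "compact U" "continuous_on U f"
  shows "integrable (povm_measure U T M) f"
  by (rule integrable_continuous_on_compact[OF finite_measure_povm_measure[OF assms(1-3)]
        sets_povm_measure assms(4,5)])

lemma integral_povm_measure_le:
  fixes f g :: "'b::metric_space \<Rightarrow> real"
  assumes povm: "is_povm U M" "trace_class T" "positive_op T" "compact U"
    and "continuous_on U f" "continuous_on U g" and f_le: "\<And>u. u \<in> U \<Longrightarrow> f u \<le> g u + e"
  shows "(\<integral>u. f u \<partial>povm_measure U T M) \<le> (\<integral>u. g u \<partial>povm_measure U T M) + e * Re (trace T)"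
proof -
  interpret finite_measure "povm_measure U T M"
    by (rule finite_measure_povm_measure[OF povm(1-3)])
  note integrable = integrable_povm_measure[OF povm]
  have "(\<integral>u. f u \<partial>povm_measure U T M) \<le> (\<integral>u. g u + e \<partial>povm_measure U T M)"
    using integrable assms(5,6) f_le by (intro integral_mono) (auto simp: space_povm_measure)
  also have "\<dots> = (\<integral>u. g u \<partial>povm_measure U T M) + e * Re (trace T)"
    using integrable[OF assms(6)]
    by (simp add: space_povm_measure measure_povm_measure_space[OF povm(1-3)] mult.commute)
  finally show ?thesis .
qed

lemma integral_povm_mixture_le:
  fixes f :: "'b::metric_space \<Rightarrow> real"
  assumes M: "is_povm U M" and N: "is_povm U N" and t: "0 \<le> t" "t \<le> 1"
    and T: "trace_class T" "positive_op T"
    and "compact U" "continuous_on U f" "\<And>u. u \<in> U \<Longrightarrow> 0 \<le> f u"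
  shows "(\<integral>u. f u \<partial>povm_measure U T (povm_mixture t M N)) \<le>
    t * (\<integral>u. f u \<partial>povm_measure U T M) + (1 - t) * (\<integral>u. f u \<partial>povm_measure U T N)"
proof (rule integral_le_combination)
  fix A assume "A \<in> sets (povm_measure U T (povm_mixture t M N))"
  then have A: "A \<in> borel_sets_on U"
    by (simp add: sets_povm_measure)
  have "trace (T \<circ> povm_mixture t M N A) = t * trace (T \<circ> M A) + (1 - t) * trace (T \<circ> N A)"
    using trace_comp_combination[OF T(1) povm_positive[OF M A] povm_positive[OF N A], of t "1 - t"]
      t by (simp add: povm_mixture_def[abs_def])
  then show "emeasure (povm_measure U T (povm_mixture t M N)) A \<le>
      ennreal t * emeasure (povm_measure U T M) A +
      ennreal (1 - t) * emeasure (povm_measure U T N) A"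
    using t trace_comp_nonneg[OF T povm_positive[OF M A]]
      trace_comp_nonneg[OF T povm_positive[OF N A]]
    by (simp add: emeasure_povm_measure[OF _ T A] M N is_povm_mixture
        flip: ennreal_mult ennreal_plus)
qed (use assms in \<open>simp_all add: sets_povm_measure space_povm_measure integrable_povm_measure\<close>)

lemma integral_povm_measure_mono_op:
  fixes f :: "'b::metric_space \<Rightarrow> real"
  assumes M: "is_povm U M" and S: "trace_class S" "positive_op S"
    and T: "trace_class T" "positive_op T" and X: "trace_class X" "positive_op X"
    and le_X: "op_le (\<lambda>z. S z - T z) X"
    and "compact U" "continuous_on U f" "\<And>u. u \<in> U \<Longrightarrow> 0 \<le> f u"
  shows "(\<integral>u. f u \<partial>povm_measure U S M) \<le>
    (\<integral>u. f u \<partial>povm_measure U T M) + (\<integral>u. f u \<partial>povm_measure U X M)"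
proof -
  have "(\<integral>u. f u \<partial>povm_measure U S M) \<le>
    1 * (\<integral>u. f u \<partial>povm_measure U T M) + 1 * (\<integral>u. f u \<partial>povm_measure U X M)"
  proof (rule integral_le_combination)
    fix A assume "A \<in> sets (povm_measure U S M)"
    then have A: "A \<in> borel_sets_on U"
      by (simp add: sets_povm_measure)
    note positive = povm_positive[OF M A]
    show "emeasure (povm_measure U S M) A \<le>
        ennreal 1 * emeasure (povm_measure U T M) A + ennreal 1 * emeasure (povm_measure U X M) A"
      using trace_comp_le[OF S(1) T(1) X(1) le_X positive]
        trace_comp_nonneg[OF T positive] trace_comp_nonneg[OF X positive]
      by (simp add: emeasure_povm_measure[OF M _ _ A] S T X flip: ennreal_plus)
  qed (use assms in \<open>simp_all add: sets_povm_measure space_povm_measure integrable_povm_measure\<close>)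
  then show ?thesis by simp
qed

section \<open>Risk functions\<close>

lemma continuous_on_section:
  assumes "continuous_on (S \<times> T) f" "x \<in> S"
  shows "continuous_on T (\<lambda>y. f (x, y))"
  using assms(2) by (intro continuous_on_compose2[OF assms(1)] continuous_intros) auto

lemma uniformly_equicontinuous_on_sections:
  fixes f :: "'a::metric_space \<times> 'b::metric_space \<Rightarrow> 'c::metric_space"
  assumes "compact S" "compact T" "continuous_on (S \<times> T) f"
  shows "uniformly_equicontinuous_on S ((\<lambda>y x. f (x, y)) ` T)"
  unfolding uniformly_equicontinuous_on_def
proof (intro allI impI)
  fix e :: real assume "0 < e"
  then obtain d where "0 < d"
    and "\<forall>p\<in>S \<times> T. \<forall>q\<in>S \<times> T. dist q p < d \<longrightarrow> dist (f q) (f p) < e"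
    using compact_uniformly_continuous[OF assms(3) compact_Times[OF assms(1,2)]]
    unfolding uniformly_continuous_on_def by blast
  then show "\<exists>d>0. \<forall>g\<in>(\<lambda>y x. f (x, y)) ` T. \<forall>x\<in>S. \<forall>x'\<in>S. dist x x' < d \<longrightarrow> dist (g x) (g x') < e"
    by (intro exI[of _ d]) (auto simp: dist_Pair_Pair)
qed

lemma quantum_modelD:
  assumes "quantum_model \<Theta> \<rho>" "\<theta> \<in> \<Theta>"
  shows "trace_class (\<rho> \<theta>)" "positive_op (\<rho> \<theta>)" "trace (\<rho> \<theta>) = 1"
  using assms unfolding quantum_model_def by auto

lemma convexlike_risk:
  fixes \<Theta> :: "'a::metric_space set" and U :: "'b::metric_space set"
    and \<rho> :: "'a \<Rightarrow> 'h::chilbert_space \<Rightarrow> 'h"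
  assumes "compact U" "quantum_model \<Theta> \<rho>" "continuous_on (\<Theta> \<times> U) w" "\<forall>p\<in>\<Theta> \<times> U. 0 \<le> w p"
  shows "convexlike (Povm U) \<Theta> (risk U \<rho> w)"
proof (rule convexlikeI)
  fix M N :: "'b set \<Rightarrow> 'h \<Rightarrow> 'h" and t :: real
  assume "M \<in> Povm U" "N \<in> Povm U" and t: "0 \<le> t" "t \<le> 1"
  then have povm: "is_povm U M" "is_povm U N"
    by (simp_all add: Povm_def)
  have "risk U \<rho> w (povm_mixture t M N) \<theta> \<le> t * risk U \<rho> w M \<theta> + (1 - t) * risk U \<rho> w N \<theta>"
    if "\<theta> \<in> \<Theta>" for \<theta>
    unfolding risk_def
    using assms that
    by (intro integral_povm_mixture_le povm t quantum_modelD[OF assms(2)] continuous_on_section)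
      auto
  then show "\<exists>K\<in>Povm U. \<forall>\<theta>\<in>\<Theta>. risk U \<rho> w K \<theta> \<le> t * risk U \<rho> w M \<theta> + (1 - t) * risk U \<rho> w N \<theta>"
    using is_povm_mixture[OF povm t] by (auto simp: Povm_def)
qed

lemma regular_dominated:
  assumes "regular \<Theta> T" "compact K" "K \<subseteq> \<Theta>" "0 < e"
  obtains d X where "0 < d" "trace_class X" "Re (trace X) < e"
    "\<And>\<theta> \<eta>. \<theta> \<in> K \<Longrightarrow> \<eta> \<in> K \<Longrightarrow> dist \<theta> \<eta> < d \<Longrightarrow> op_le (\<lambda>z. T \<theta> z - T \<eta> z) X"
proof -
  have "((\<lambda>d. omega T K d) \<longlongrightarrow> 0) (at_right 0)"
    using assms(1-3) unfolding regular_def by blast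
  then have "\<forall>\<^sub>F d in at_right 0. omega T K d < ereal e"
    using \<open>0 < e\<close> by (intro order_tendstoD(2)) auto
  then have "\<exists>d>0. omega T K d < ereal e"
    unfolding eventually_at_right_field by (meson field_lbound_gt_zero zero_less_one)
  then obtain d X where "0 < d" and X: "trace_class X" "trace_norm X < e"
    and "\<And>\<theta> \<eta>. \<theta> \<in> K \<Longrightarrow> \<eta> \<in> K \<Longrightarrow> dist \<theta> \<eta> < d \<Longrightarrow> op_le (\<lambda>z. T \<theta> z - T \<eta> z) X"
    unfolding omega_def Inf_less_iff Kdelta_def by auto
  moreover have "Re (trace X) < e"
    using norm_trace_le_trace_norm[OF X(1)] X(2) complex_Re_le_cmod[of "trace X"] by simp
  ultimately show ?thesis
    by (intro that[of d X])
qed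

lemma risk_le_of_op_le:
  assumes M: "is_povm U M" and "compact U" and \<rho>: "quantum_model \<Theta> \<rho>" and "\<theta> \<in> \<Theta>" "\<eta> \<in> \<Theta>"
    and X: "trace_class X" "positive_op X" "op_le (\<lambda>z. \<rho> \<theta> z - \<rho> \<eta> z) X"
    and w: "continuous_on (\<Theta> \<times> U) w" "\<And>p. p \<in> \<Theta> \<times> U \<Longrightarrow> 0 \<le> w p" "\<And>p. p \<in> \<Theta> \<times> U \<Longrightarrow> w p \<le> C"
    and w_le: "\<And>u. u \<in> U \<Longrightarrow> w (\<theta>, u) \<le> w (\<eta>, u) + e"
  shows "risk U \<rho> w M \<theta> \<le> risk U \<rho> w M \<eta> + e + C * Re (trace X)"
proof -
  let ?w\<theta> = "\<lambda>u. w (\<theta>, u)" and ?w\<eta> = "\<lambda>u. w (\<eta>, u)"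
  note state\<theta> = quantum_modelD[OF \<rho> \<open>\<theta> \<in> \<Theta>\<close>] and state\<eta> = quantum_modelD[OF \<rho> \<open>\<eta> \<in> \<Theta>\<close>]
  note cont\<theta> = continuous_on_section[OF w(1) \<open>\<theta> \<in> \<Theta>\<close>]
    and cont\<eta> = continuous_on_section[OF w(1) \<open>\<eta> \<in> \<Theta>\<close>]
  have "risk U \<rho> w M \<theta> \<le>
      (\<integral>u. ?w\<theta> u \<partial>povm_measure U (\<rho> \<eta>) M) + (\<integral>u. ?w\<theta> u \<partial>povm_measure U X M)"
    unfolding risk_def using assms
    by (intro integral_povm_measure_mono_op M state\<theta> state\<eta> X cont\<theta>) auto
  also have "(\<integral>u. ?w\<theta> u \<partial>povm_measure U (\<rho> \<eta>) M) \<le> risk U \<rho> w M \<eta> + e * Re (trace (\<rho> \<eta>))"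
    unfolding risk_def
    by (intro integral_povm_measure_le M state\<eta> assms(2) cont\<theta> cont\<eta> w_le)
  also have "(\<integral>u. ?w\<theta> u \<partial>povm_measure U X M) \<le> (\<integral>u. 0 \<partial>povm_measure U X M) + C * Re (trace X)"
    using w(3) \<open>\<theta> \<in> \<Theta>\<close> by (intro integral_povm_measure_le M X assms(2) cont\<theta>) auto
  finally show ?thesis
    by (simp add: state\<eta>)
qed

lemma risk_less_if_close:
  fixes \<Theta> :: "'a::metric_space set" and U :: "'b::metric_space set"
    and \<rho> :: "'a \<Rightarrow> 'h::chilbert_space \<Rightarrow> 'h"
  assumes "compact \<Theta>" "compact U" and \<rho>: "quantum_model \<Theta> \<rho>"
    and w: "continuous_on (\<Theta> \<times> U) w" and nonneg: "\<forall>p\<in>\<Theta> \<times> U. 0 \<le> w p" and "0 < e"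
  obtains d where "0 < d"
    "\<And>M \<theta> \<eta>. M \<in> Povm U \<Longrightarrow> \<theta> \<in> \<Theta> \<Longrightarrow> \<eta> \<in> \<Theta> \<Longrightarrow> dist \<theta> \<eta> < d \<Longrightarrow>
      risk U \<rho> w M \<theta> < risk U \<rho> w M \<eta> + e"
proof -
  obtain B where "0 \<le> B" and w_le_B: "\<And>p. p \<in> \<Theta> \<times> U \<Longrightarrow> norm (w p) \<le> B"
    using continuous_on_compact_bound[OF compact_Times[OF assms(1,2)] w] by blast
  define C where "C = B + 1"
  have "0 < C" and w_le_C: "\<And>p. p \<in> \<Theta> \<times> U \<Longrightarrow> w p \<le> C"
    using \<open>0 \<le> B\<close> w_le_B by (fastforce simp: C_def)+
  obtain d1 where "0 < d1"
    and w_close: "\<forall>f\<in>(\<lambda>u \<theta>. w (\<theta>, u)) ` U. \<forall>\<theta>\<in>\<Theta>. \<forall>\<eta>\<in>\<Theta>. dist \<theta> \<eta> < d1 \<longrightarrow>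
      dist (f \<theta>) (f \<eta>) < e / 2"
    using uniformly_equicontinuous_on_sections[OF assms(1,2) w] half_gt_zero[OF \<open>0 < e\<close>]
    unfolding uniformly_equicontinuous_on_def by blast
  obtain d2 X where "0 < d2" and X: "trace_class X" "Re (trace X) < e / (2 * C)"
    and le_X: "\<And>\<theta> \<eta>. \<theta> \<in> \<Theta> \<Longrightarrow> \<eta> \<in> \<Theta> \<Longrightarrow> dist \<theta> \<eta> < d2 \<Longrightarrow> op_le (\<lambda>z. \<rho> \<theta> z - \<rho> \<eta> z) X"
    using regular_dominated[of \<Theta> \<rho> \<Theta> "e / (2 * C)"] \<rho> assms(1) \<open>0 < e\<close> \<open>0 < C\<close>
    unfolding quantum_model_def by auto
  have "risk U \<rho> w M \<theta> < risk U \<rho> w M \<eta> + e"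
    if "M \<in> Povm U" "\<theta> \<in> \<Theta>" "\<eta> \<in> \<Theta>" "dist \<theta> \<eta> < min d1 d2" for M \<theta> \<eta>
  proof -
    have "positive_op X"
      using le_X[of \<theta> \<theta>] that(2) \<open>0 < d2\<close> by (simp add: op_le_def)
    have "w (\<theta>, u) \<le> w (\<eta>, u) + e / 2" if "u \<in> U" for u
    proof -
      have "dist (w (\<theta>, u)) (w (\<eta>, u)) < e / 2"
        using w_close that \<open>\<theta> \<in> \<Theta>\<close> \<open>\<eta> \<in> \<Theta>\<close> \<open>dist \<theta> \<eta> < min d1 d2\<close> by auto
      then show ?thesis
        unfolding dist_real_def by linarith
    qed
    then have "risk U \<rho> w M \<theta> \<le> risk U \<rho> w M \<eta> + e / 2 + C * Re (trace X)"
      using that nonneg w_le_C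
      by (intro risk_le_of_op_le[OF _ assms(2) \<rho> _ _ X(1) \<open>positive_op X\<close> le_X w])
        (auto simp: Povm_def)
    also have "\<dots> < risk U \<rho> w M \<eta> + e"
      using X(2) \<open>0 < C\<close> by (simp add: field_simps)
    finally show ?thesis .
  qed
  with \<open>0 < d1\<close> \<open>0 < d2\<close> show ?thesis
    by (intro that[of "min d1 d2"]) auto
qed

lemma uniformly_equicontinuous_on_risk:
  fixes \<Theta> :: "'a::metric_space set" and U :: "'b::metric_space set"
    and \<rho> :: "'a \<Rightarrow> 'h::chilbert_space \<Rightarrow> 'h"
  assumes "compact \<Theta>" "compact U" "quantum_model \<Theta> \<rho>"
    "continuous_on (\<Theta> \<times> U) w" "\<forall>p\<in>\<Theta> \<times> U. 0 \<le> w p"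
  shows "uniformly_equicontinuous_on \<Theta> (risk U \<rho> w ` Povm U)"
  unfolding uniformly_equicontinuous_on_def
proof (intro allI impI)
  fix e :: real assume "0 < e"
  then obtain d where "0 < d" and risk_less: "\<And>M \<theta> \<eta>. M \<in> Povm U \<Longrightarrow> \<theta> \<in> \<Theta> \<Longrightarrow> \<eta> \<in> \<Theta> \<Longrightarrow>
      dist \<theta> \<eta> < d \<Longrightarrow> risk U \<rho> w M \<theta> < risk U \<rho> w M \<eta> + e"
    using risk_less_if_close[OF assms] by metis
  have "dist (risk U \<rho> w M \<theta>) (risk U \<rho> w M \<eta>) < e"
    if "M \<in> Povm U" "\<theta> \<in> \<Theta>" "\<eta> \<in> \<Theta>" "dist \<theta> \<eta> < d" for M \<theta> \<eta>
    using risk_less[OF that] risk_less[OF that(1,3,2)] that(4)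
    by (simp add: dist_commute dist_real_def abs_less_iff)
  with \<open>0 < d\<close>
  show "\<exists>d>0. \<forall>f\<in>risk U \<rho> w ` Povm U. \<forall>\<theta>\<in>\<Theta>. \<forall>\<eta>\<in>\<Theta>. dist \<theta> \<eta> < d \<longrightarrow> dist (f \<theta>) (f \<eta>) < e"
    by blast
qed

theorem theorem2:
  fixes \<Theta> :: "'a::metric_space set" and U :: "'b::metric_space set"
    and \<rho> :: "'a \<Rightarrow> 'h::chilbert_space \<Rightarrow> 'h" and w :: "'a \<times> 'b \<Rightarrow> real"
  assumes "compact \<Theta>" and "\<Theta> \<noteq> {}" and "compact U"
    and "quantum_model \<Theta> \<rho>"
    and "continuous_on (\<Theta> \<times> U) w"
    and "bounded (w ` (\<Theta> \<times> U))"
    and "\<forall>p \<in> \<Theta> \<times> U. 0 \<le> w p"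
  shows "(INF M \<in> Povm U. SUP \<theta> \<in> \<Theta>. ereal (risk U \<rho> w M \<theta>)) =
         (SUP \<pi> \<in> prob_measures \<Theta>. INF M \<in> Povm U. ereal (\<integral>\<theta>. risk U \<rho> w M \<theta> \<partial>\<pi>))"
proof (rule prior_minimax)
  show "convexlike (Povm U) \<Theta> (risk U \<rho> w)"
    using assms by (intro convexlike_risk)
  show "uniformly_equicontinuous_on \<Theta> (risk U \<rho> w ` Povm U)"
    using assms by (intro uniformly_equicontinuous_on_risk)
qed (fact assms)+

end
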